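(* Let $\mathbf T$ be an $\mathbb R$-torus. Consider the canonical $\Gamma$-equivariant evaluation homomorphism $$\mathrm{ev}\colon\mathsf X_*(\mathbf T)\to\mathbf T(\mathbb C),\qquad\nu\mapsto\nu(-1)\ \text{ for }\nu\in\mathsf X_*(\mathbf T).$$ Then for any $k\in\mathbb Z$, the induced homomorphism $$\mathrm{ev}_*^k\colon\mathrm H^k\,\mathsf X_*(\mathbf T)\to\mathrm H^k\,\mathbf T,\qquad[\nu]\mapsto[\nu(-1)]$$ is an isomorphism.
   Context: $\Gamma=\mathrm{Gal}(\mathbb C/\mathbb R)=\{1,\gamma\}$. For a $\Gamma$-module $A$ (written additively) and $k\in\mathbb Z$, $\mathrm H^kA$ denotes Tate cohomology: $\mathrm H^kA=\mathrm Z^kA/\mathrm B^kA$ with $\mathrm Z^kA=\{a\in A:{}^\gamma a=(-1)^ka\}$, $\mathrm B^kA=\{{}^\gamma a'+(-1)^ka':a'\in A\}$. For a commutative $\mathbb R$-group $\mathbf A$, $\mathrm H^k\mathbf A=\mathrm H^k(\mathbf A(\mathbb C))$ (with $\mathbf A(\mathbb C)$ written multiplicatively). $\mathsf X_*(\mathbf T)=\mathrm{Hom}(\mathbb G_{m,\mathbb C},\mathbf T_{\mathbb C})$ is the cocharacter group with $({}^\gamma\nu)(z)={}^\gamma(\nu({}^{\gamma^{-1}}z))$ for $z\in\mathbb C^\times$. *)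

theory Defs
  imports Complex_Main "HOL-Algebra.Product_Groups"
begin

text \<open>
  The \<open>K\<close>-algebra of complex-valued functions on \<open>X\<close> generated by \<open>F\<close>. All functions are taken
  extensional on \<open>X\<close>, so that equality of elements is equality of functions on \<open>X\<close>.
\<close>

inductive_set function_algebra ::
    "complex set \<Rightarrow> 'a set \<Rightarrow> ('a \<Rightarrow> complex) set \<Rightarrow> ('a \<Rightarrow> complex) set"
  for K X F where
  const: "c \<in> K \<Longrightarrow> (\<lambda>x\<in>X. c) \<in> function_algebra K X F"
| gen: "f \<in> F \<Longrightarrow> restrict f X \<in> function_algebra K X F"
| add: "\<lbrakk>f \<in> function_algebra K X F; g \<in> function_algebra K X F\<rbrakk>
    \<Longrightarrow> (\<lambda>x\<in>X. f x + g x) \<in> function_algebra K X F"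
| mult: "\<lbrakk>f \<in> function_algebra K X F; g \<in> function_algebra K X F\<rbrakk>
    \<Longrightarrow> (\<lambda>x\<in>X. f x * g x) \<in> function_algebra K X F"

definition algebra_hom_to_complex ::
    "complex set \<Rightarrow> 'a set \<Rightarrow> ('a \<Rightarrow> complex) set \<Rightarrow> (('a \<Rightarrow> complex) \<Rightarrow> complex) \<Rightarrow> bool" where
  "algebra_hom_to_complex K X R h \<longleftrightarrow>
     (\<forall>c\<in>K. h (\<lambda>x\<in>X. c) = c) \<and>
     (\<forall>f\<in>R. \<forall>g\<in>R. h (\<lambda>x\<in>X. f x + g x) = h f + h g \<and> h (\<lambda>x\<in>X. f x * g x) = h f * h g)"

text \<open>
  An affine algebraic \<open>K\<close>-group \<open>G\<close> (with \<open>K\<close> the set of real or of all complex numbers) is given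
  by its group of complex points \<open>G(\<complex>)\<close> (the \<open>monoid\<close> part of the record) and its coordinate
  ring \<open>K[G]\<close>, whose elements are regarded as functions on \<open>G(\<complex>)\<close>. This loses nothing, because
  algebraic groups in characteristic 0 are geometrically reduced (Cartier).
\<close>

record 'a affine_grp = "'a monoid" +
  coord_ring :: "('a \<Rightarrow> complex) set"

text \<open>
  \<open>points_separated\<close> and \<open>points_exhaust\<close> say \<open>G(\<complex>) = Hom\<^bsub>K-alg\<^esub>(K[G], \<complex>)\<close>. In \<open>comult\<close>, the
  functions on \<open>G(\<complex>) \<times> G(\<complex>)\<close> generated by those of the two factors form the coordinate ring
  \<open>K[G] \<otimes> K[G]\<close> of \<open>G \<times> G\<close>.
\<close>

locale affine_algebraic_group = group G
  for K :: "complex set" and G :: "'a affine_grp" (structure) +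
  assumes finitely_generated:
    "\<exists>F. finite F \<and> coord_ring G = function_algebra K (carrier G) F"
  and points_separated:
    "\<lbrakk>x \<in> carrier G; y \<in> carrier G; \<forall>f\<in>coord_ring G. f x = f y\<rbrakk> \<Longrightarrow> x = y"
  and points_exhaust:
    "algebra_hom_to_complex K (carrier G) (coord_ring G) h
      \<Longrightarrow> \<exists>x\<in>carrier G. \<forall>f\<in>coord_ring G. h f = f x"
  and comult:
    "f \<in> coord_ring G \<Longrightarrow>
      (\<lambda>p\<in>carrier G \<times> carrier G. f (fst p \<otimes> snd p))
        \<in> function_algebra K (carrier G \<times> carrier G)
            ((\<lambda>g p. g (fst p)) ` coord_ring G \<union> (\<lambda>g p. g (snd p)) ` coord_ring G)"
  and antipode:
    "f \<in> coord_ring G \<Longrightarrow> (\<lambda>x\<in>carrier G. f (inv x)) \<in> coord_ring G"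

text \<open>
  \<open>G\<close> and \<open>H\<close> have the same base field here; homomorphisms are extensional outside the carrier,
  which makes equality in the cocharacter group below the right one.
\<close>

definition alg_group_hom :: "'a affine_grp \<Rightarrow> 'b affine_grp \<Rightarrow> ('a \<Rightarrow> 'b) set" where
  "alg_group_hom G H =
     {\<phi> \<in> hom G H \<inter> extensional (carrier G).
        \<forall>f\<in>coord_ring H. (\<lambda>x\<in>carrier G. f (\<phi> x)) \<in> coord_ring G}"

definition alg_group_isomorphic :: "'a affine_grp \<Rightarrow> 'b affine_grp \<Rightarrow> bool" where
  "alg_group_isomorphic G H \<longleftrightarrow>
     (\<exists>\<phi>\<in>alg_group_hom G H. \<exists>\<psi>\<in>alg_group_hom H G.
        (\<forall>x\<in>carrier G. \<psi> (\<phi> x) = x) \<and> (\<forall>y\<in>carrier H. \<phi> (\<psi> y) = y))"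

text \<open>The base change of a real group to \<open>\<complex>\<close>: same complex points, \<open>\<complex>[G] = \<complex> \<otimes> \<real>[G]\<close>.\<close>

definition base_change :: "'a affine_grp \<Rightarrow> 'a affine_grp" where
  "base_change G = G\<lparr>coord_ring := function_algebra UNIV (carrier G) (coord_ring G)\<rparr>"

definition Gm :: "complex affine_grp" where
  "Gm = \<lparr>carrier = UNIV - {0}, monoid.mult = (*), one = 1,
         coord_ring = function_algebra UNIV (UNIV - {0}) {\<lambda>z. z, inverse}\<rparr>"

definition Gm_power :: "nat \<Rightarrow> (nat \<Rightarrow> complex) affine_grp" where
  "Gm_power r =
     (let P = product_group {..<r} (\<lambda>_. Gm) in
      \<lparr>carrier = carrier P, monoid.mult = monoid.mult P, one = one P,
       coord_ring = function_algebra UNIV (carrier P)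
         ((\<lambda>i t. t i) ` {..<r} \<union> (\<lambda>i t. inverse (t i)) ` {..<r})\<rparr>)"

definition real_torus :: "'a affine_grp \<Rightarrow> bool" where
  "real_torus T \<longleftrightarrow>
     affine_algebraic_group \<real> T \<and> (\<exists>r. alg_group_isomorphic (base_change T) (Gm_power r))"

text \<open>
  The action of complex conjugation \<open>\<gamma>\<close> on \<open>G(\<complex>) = Hom\<^bsub>\<real>-alg\<^esub>(\<real>[G], \<complex>)\<close> is by composition:
  \<open>\<gamma> x\<close> is the point at which every \<open>f\<close> in \<open>\<real>[G]\<close> takes the value conjugate to \<open>f x\<close>.
\<close>

definition gal_point :: "'a affine_grp \<Rightarrow> 'a \<Rightarrow> 'a" where
  "gal_point G x = (THE y. y \<in> carrier G \<and> (\<forall>f\<in>coord_ring G. f y = cnj (f x)))"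

definition cochar_group :: "'a affine_grp \<Rightarrow> (complex \<Rightarrow> 'a) monoid" where
  "cochar_group T =
     \<lparr>carrier = alg_group_hom Gm (base_change T),
      monoid.mult = (\<lambda>\<mu> \<nu>. \<lambda>z\<in>carrier Gm. \<mu> z \<otimes>\<^bsub>T\<^esub> \<nu> z),
      one = (\<lambda>z\<in>carrier Gm. \<one>\<^bsub>T\<^esub>)\<rparr>"

definition gal_cochar :: "'a affine_grp \<Rightarrow> (complex \<Rightarrow> 'a) \<Rightarrow> complex \<Rightarrow> 'a" where
  "gal_cochar T \<nu> = (\<lambda>z\<in>carrier Gm. gal_point T (\<nu> (cnj z)))"

definition ev_minus_one :: "(complex \<Rightarrow> 'a) \<Rightarrow> 'a" where
  "ev_minus_one \<nu> = \<nu> (-1)"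

text \<open>
  A \<open>\<Gamma>\<close>-module is an abelian group \<open>A\<close>, in multiplicative notation throughout, together with the
  action \<open>\<gamma>\<close> of the nontrivial element of \<open>\<Gamma>\<close>; so \<open>(-1)\<^sup>k a\<close> becomes the power of \<open>a\<close> with
  exponent \<open>alt_sign k\<close>.
\<close>

definition alt_sign :: "int \<Rightarrow> int" where
  "alt_sign k = (if even k then 1 else -1)"

definition tate_Z :: "('a, 'b) monoid_scheme \<Rightarrow> ('a \<Rightarrow> 'a) \<Rightarrow> int \<Rightarrow> 'a set" where
  "tate_Z A \<gamma> k = {a \<in> carrier A. \<gamma> a = a [^]\<^bsub>A\<^esub> alt_sign k}"

definition tate_B :: "('a, 'b) monoid_scheme \<Rightarrow> ('a \<Rightarrow> 'a) \<Rightarrow> int \<Rightarrow> 'a set" where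
  "tate_B A \<gamma> k = {\<gamma> a \<otimes>\<^bsub>A\<^esub> a [^]\<^bsub>A\<^esub> alt_sign k | a. a \<in> carrier A}"

definition tate_H :: "('a, 'b) monoid_scheme \<Rightarrow> ('a \<Rightarrow> 'a) \<Rightarrow> int \<Rightarrow> 'a set monoid" where
  "tate_H A \<gamma> k = (A\<lparr>carrier := tate_Z A \<gamma> k\<rparr>) Mod (tate_B A \<gamma> k)"

definition tate_class :: "('a, 'b) monoid_scheme \<Rightarrow> ('a \<Rightarrow> 'a) \<Rightarrow> int \<Rightarrow> 'a \<Rightarrow> 'a set" where
  "tate_class A \<gamma> k a = tate_B A \<gamma> k #>\<^bsub>A\<^esub> a"

text \<open>
  The map on cohomology induced by \<open>f\<close>; \<open>the_elem\<close> is meaningful exactly because the class of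
  \<open>f a\<close> does not depend on the representative \<open>a\<close> of \<open>C\<close> when \<open>f\<close> is an equivariant homomorphism.
\<close>

definition tate_map ::
    "('b, 'd) monoid_scheme \<Rightarrow> ('b \<Rightarrow> 'b) \<Rightarrow> int \<Rightarrow> ('a \<Rightarrow> 'b) \<Rightarrow> 'a set \<Rightarrow> 'b set" where
  "tate_map B \<beta> k f C = the_elem ((\<lambda>a. tate_class B \<beta> k (f a)) ` C)"

end

theory Submission
  imports
    Defs
    "HOL-Computational_Algebra.Polynomial"
    "HOL-Analysis.Complex_Transcendental"
    "HOL-Library.Function_Algebras"
begin

text \<open>
  Choose an isomorphism \<open>T(\<complex>) \<cong> (\<complex>\<^sup>\<times>)\<^sup>r\<close> and write \<open>X\<close> for the cocharacter group. Its exponential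
  turns \<open>T(\<complex>)\<close> into a quotient of the complex vector space \<open>W = \<complex>\<^sup>r = X \<otimes> \<complex>\<close>, and complex conjugation on
  \<open>T(\<complex>)\<close> lifts to the semilinear involution \<open>\<sigma>\<close> of \<open>W\<close> that is \<open>\<gamma>\<close> on \<open>X\<close> and complex conjugation
  on \<open>\<complex>\<close>. With \<open>\<iota> \<nu> = \<pi>i \<nu>\<close> this gives an exact sequence

  \<open>0 \<rightarrow> X \<rightarrow> W \<rightarrow> T(\<complex>) \<rightarrow> 0\<close>

  whose first map is \<open>2\<iota>\<close> and whose second map is \<open>E = exp\<close>. Conjugation changes the sign of \<open>\<pi>i\<close>, so
  \<open>\<sigma> \<circ> \<iota> = - \<iota> \<circ> \<gamma>\<close>. Since \<open>exp (\<pi>i n) = (-1)\<^sup>n\<close>, the evaluation \<open>\<nu> \<mapsto> \<nu>(-1)\<close> is just \<open>E \<circ> \<iota>\<close>.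
  Multiplication by 2 is bijective on \<open>W\<close>, so \<open>W\<close> has no Tate cohomology, and the connecting map
  identifies \<open>H\<^sup>k T\<close> with the cohomology in degree \<open>k + 1\<close> of \<open>X\<close> with the sign-twisted action, which
  is \<open>H\<^sup>k X\<close>.

  This dimension shift can be carried out on elements. Let \<open>s = (-1)\<^sup>k\<close>. If \<open>E w\<close> is a \<open>k\<close>-cocycle, then
  \<open>\<sigma> w = s w + 2 \<iota> n\<close> for some \<open>n\<close> in \<open>X\<close>; applying \<open>\<sigma>\<close> shows that \<open>n\<close> is a cocycle, and
  \<open>h = s w / 2\<close> satisfies \<open>\<sigma> h + s h = w + s \<iota> n\<close>, so \<open>E w\<close> is cohomologous to \<open>ev (- s n)\<close>
  (\<open>cocycle_is_coboundary_times_ev\<close>). Conversely, if \<open>\<nu>\<close> is a cocycle and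
  \<open>\<iota> \<nu> = (\<sigma> w + s w) + 2 \<iota> m\<close>, then comparing with the image under \<open>\<sigma>\<close> gives
  \<open>\<nu> = s \<gamma> m + m\<close>, which is a coboundary (\<open>coboundary_if_ev_coboundary\<close>).

  The algebraic geometry enters in producing the exact sequence. The algebraic characters of the
  multiplicative group are the integral powers (\<open>Gm_character_is_power\<close>), so that \<open>X\<close> is \<open>\<int>\<^sup>r\<close>.
  The comultiplication of \<open>T\<close> is defined over \<open>\<real>\<close>, so that complex conjugation on \<open>T(\<complex>)\<close> is a
  group homomorphism (\<open>gal_point_mult\<close>). The formula for \<open>\<sigma>\<close> then comes from
  \<open>\<gamma> (\<nu> z) = (\<gamma> \<nu>) (cnj z)\<close> for basis cocharacters \<open>\<nu>\<close>.
\<close>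

section \<open>Tate cohomology of modules with an involution\<close>

locale conjugation_module = comm_group A for A (structure) +
  fixes \<gamma> :: "'a \<Rightarrow> 'a"
  assumes conj_hom: "\<gamma> \<in> hom A A"
    and conj_conj: "a \<in> carrier A \<Longrightarrow> \<gamma> (\<gamma> a) = a"
begin

lemma conj_closed [simp]: "a \<in> carrier A \<Longrightarrow> \<gamma> a \<in> carrier A"
  using conj_hom by (auto simp: hom_def)

lemma conj_mult: "a \<in> carrier A \<Longrightarrow> b \<in> carrier A \<Longrightarrow> \<gamma> (a \<otimes> b) = \<gamma> a \<otimes> \<gamma> b"
  using conj_hom by (auto simp: hom_def)

sublocale conj: group_hom A A \<gamma>
  by (unfold_locales) (rule conj_hom)

lemma conj_alt_pow:
  "a \<in> carrier A \<Longrightarrow> \<gamma> (a [^] (n::int)) = \<gamma> a [^] n"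
  by (simp add: conj.hom_int_pow)

lemma subgroup_tate_Z: "subgroup (tate_Z A \<gamma> k) A"
  by (rule subgroupI)
     (auto simp: tate_Z_def conj_mult int_pow_distrib int_pow_inv intro!: exI[of _ \<one>])

lemma coboundaryI: "a \<in> carrier A \<Longrightarrow> \<gamma> a \<otimes> a [^] alt_sign k \<in> tate_B A \<gamma> k"
  by (auto simp: tate_B_def)

lemma subgroup_tate_B: "subgroup (tate_B A \<gamma> k) A"
proof (rule subgroupI)
  show "tate_B A \<gamma> k \<subseteq> carrier A"
    by (auto simp: tate_B_def)
  show "tate_B A \<gamma> k \<noteq> {}"
    by (auto simp: tate_B_def)
next
  fix b assume "b \<in> tate_B A \<gamma> k"
  then obtain a where a: "a \<in> carrier A" "b = \<gamma> a \<otimes> a [^] alt_sign k"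
    by (auto simp: tate_B_def)
  then have eq: "inv b = \<gamma> (inv a) \<otimes> (inv a) [^] alt_sign k"
    by (simp add: inv_mult int_pow_inv)
  show "inv b \<in> tate_B A \<gamma> k"
    unfolding eq using a(1) by (intro coboundaryI) simp
next
  fix b c assume "b \<in> tate_B A \<gamma> k" "c \<in> tate_B A \<gamma> k"
  then obtain x y where x: "x \<in> carrier A" "b = \<gamma> x \<otimes> x [^] alt_sign k"
    and y: "y \<in> carrier A" "c = \<gamma> y \<otimes> y [^] alt_sign k"
    by (auto simp: tate_B_def)
  then have eq: "b \<otimes> c = \<gamma> (x \<otimes> y) \<otimes> (x \<otimes> y) [^] alt_sign k"
    by (simp add: conj_mult int_pow_distrib m_ac)
  show "b \<otimes> c \<in> tate_B A \<gamma> k"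
    unfolding eq using x(1) y(1) by (intro coboundaryI) simp
qed

lemma tate_class_eq_iff:
  assumes "a \<in> carrier A" "b \<in> carrier A"
  shows "tate_class A \<gamma> k a = tate_class A \<gamma> k b \<longleftrightarrow> (\<exists>c\<in>tate_B A \<gamma> k. a = c \<otimes> b)"
proof -
  have "tate_class A \<gamma> k a = tate_class A \<gamma> k b \<longleftrightarrow> a \<in> tate_B A \<gamma> k #> b"
    using assms subgroup_tate_B unfolding tate_class_def
    by (metis rcos_self repr_independence)
  then show ?thesis
    by (auto simp: r_coset_def)
qed

lemma carrier_tate_H: "carrier (tate_H A \<gamma> k) = tate_class A \<gamma> k ` tate_Z A \<gamma> k"
  by (auto simp: tate_H_def FactGroup_def RCOSETS_def tate_class_def r_coset_def)

lemma mult_tate_H: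
  assumes "a \<in> carrier A" "b \<in> carrier A"
  shows "tate_class A \<gamma> k a \<otimes>\<^bsub>tate_H A \<gamma> k\<^esub> tate_class A \<gamma> k b = tate_class A \<gamma> k (a \<otimes> b)"
proof -
  interpret B: normal "tate_B A \<gamma> k" A
    using subgroup_tate_B by (rule subgroup_imp_normal)
  have "tate_class A \<gamma> k a <#> tate_class A \<gamma> k b = tate_class A \<gamma> k (a \<otimes> b)"
    using assms by (simp add: tate_class_def B.rcos_sum)
  then show ?thesis
    by (simp add: tate_H_def FactGroup_def set_mult_def)
qed

end

locale conjugation_hom =
  A: conjugation_module A \<alpha> + B: conjugation_module B \<beta>
  for A :: "('a, 'c) monoid_scheme" and \<alpha> and B :: "('b, 'd) monoid_scheme" and \<beta> +
  fixes f :: "'a \<Rightarrow> 'b"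
  assumes hom: "f \<in> hom A B"
    and equivariant: "a \<in> carrier A \<Longrightarrow> f (\<alpha> a) = \<beta> (f a)"
begin

sublocale group_hom A B f
  by unfold_locales (rule hom)

lemma image_tate_Z: "a \<in> tate_Z A \<alpha> k \<Longrightarrow> f a \<in> tate_Z B \<beta> k"
  by (auto simp: tate_Z_def hom_int_pow equivariant[symmetric])

lemma image_tate_B: "a \<in> tate_B A \<alpha> k \<Longrightarrow> f a \<in> tate_B B \<beta> k"
  by (auto simp: tate_B_def hom_int_pow equivariant)

text \<open>
  The image of the whole coset \<open>C\<close> in the definition of \<open>tate_map\<close> is a single class, because
  \<open>f\<close> preserves coboundaries.
\<close>

lemma tate_map_class:
  assumes "a \<in> carrier A"
  shows "tate_map B \<beta> k f (tate_class A \<alpha> k a) = tate_class B \<beta> k (f a)"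
proof -
  have "tate_class B \<beta> k (f x) = tate_class B \<beta> k (f a)" if x: "x \<in> tate_class A \<alpha> k a" for x
  proof -
    obtain c where c: "c \<in> tate_B A \<alpha> k" "x = c \<otimes>\<^bsub>A\<^esub> a"
      using x by (auto simp: tate_class_def r_coset_def)
    have "c \<in> carrier A"
      using c(1) subgroup.subset[OF A.subgroup_tate_B] by auto
    with c assms show ?thesis
      by (subst B.tate_class_eq_iff) (auto intro!: image_tate_B)
  qed
  moreover have "a \<in> tate_class A \<alpha> k a"
    unfolding tate_class_def using assms A.subgroup_tate_B by (rule A.rcos_self)
  ultimately have "(\<lambda>x. tate_class B \<beta> k (f x)) ` tate_class A \<alpha> k a = {tate_class B \<beta> k (f a)}"
    by blast
  then show ?thesis
    by (simp add: tate_map_def)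
qed

text \<open>
  The two hypotheses are injectivity and surjectivity on cohomology, stated for representatives
  so that no quotient group has to be handled afterwards.
\<close>

lemma tate_map_iso:
  assumes inj: "\<And>a. \<lbrakk>a \<in> tate_Z A \<alpha> k; f a \<in> tate_B B \<beta> k\<rbrakk> \<Longrightarrow> a \<in> tate_B A \<alpha> k"
    and surj: "\<And>b. b \<in> tate_Z B \<beta> k \<Longrightarrow> \<exists>a\<in>tate_Z A \<alpha> k. \<exists>c\<in>tate_B B \<beta> k. b = c \<otimes>\<^bsub>B\<^esub> f a"
  shows "tate_map B \<beta> k f \<in> iso (tate_H A \<alpha> k) (tate_H B \<beta> k)"
proof -
  have ZA: "a \<in> carrier A" if "a \<in> tate_Z A \<alpha> k" for a
    using that by (simp add: tate_Z_def)
  have ZB: "b \<in> carrier B" if "b \<in> tate_Z B \<beta> k" for b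
    using that by (simp add: tate_Z_def)
  have "tate_map B \<beta> k f \<in> hom (tate_H A \<alpha> k) (tate_H B \<beta> k)"
    by (rule homI)
       (auto simp: A.carrier_tate_H B.carrier_tate_H A.mult_tate_H B.mult_tate_H ZA
          tate_map_class image_tate_Z)
  moreover have "inj_on (tate_map B \<beta> k f) (carrier (tate_H A \<alpha> k))"
  proof (rule inj_onI, clarsimp simp: A.carrier_tate_H tate_map_class ZA)
    fix a a' assume a: "a \<in> tate_Z A \<alpha> k" and a': "a' \<in> tate_Z A \<alpha> k"
      and eq: "tate_class B \<beta> k (f a) = tate_class B \<beta> k (f a')"
    then obtain c where c: "c \<in> tate_B B \<beta> k" "f a = c \<otimes>\<^bsub>B\<^esub> f a'"
      using B.tate_class_eq_iff ZA by (metis hom_closed)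
    let ?d = "a \<otimes>\<^bsub>A\<^esub> inv\<^bsub>A\<^esub> a'"
    have "c \<in> carrier B"
      using c(1) subgroup.subset[OF B.subgroup_tate_B] by auto
    then have "f ?d = c"
      using c(2) ZA[OF a] ZA[OF a'] by (simp add: B.m_assoc)
    moreover have "?d \<in> tate_Z A \<alpha> k"
      using A.subgroup_tate_Z a a' by (simp add: subgroup.m_closed subgroup.m_inv_closed)
    ultimately have "?d \<in> tate_B A \<alpha> k"
      using inj c(1) by simp
    moreover have "a = ?d \<otimes>\<^bsub>A\<^esub> a'"
      using ZA[OF a] ZA[OF a'] by (simp add: A.m_assoc)
    ultimately show "tate_class A \<alpha> k a = tate_class A \<alpha> k a'"
      using A.tate_class_eq_iff ZA[OF a] ZA[OF a'] by blast
  qed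
  moreover have "tate_map B \<beta> k f ` carrier (tate_H A \<alpha> k) = carrier (tate_H B \<beta> k)"
  proof
    show "tate_map B \<beta> k f ` carrier (tate_H A \<alpha> k) \<subseteq> carrier (tate_H B \<beta> k)"
      by (auto simp: A.carrier_tate_H B.carrier_tate_H tate_map_class ZA image_tate_Z)
    show "carrier (tate_H B \<beta> k) \<subseteq> tate_map B \<beta> k f ` carrier (tate_H A \<alpha> k)"
    proof (clarsimp simp: B.carrier_tate_H)
      fix b assume b: "b \<in> tate_Z B \<beta> k"
      then obtain a where a: "a \<in> tate_Z A \<alpha> k" "\<exists>c\<in>tate_B B \<beta> k. b = c \<otimes>\<^bsub>B\<^esub> f a"
        using surj by blast
      then have "tate_class B \<beta> k b = tate_map B \<beta> k f (tate_class A \<alpha> k a)"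
        using ZA[OF a(1)] ZB[OF b] by (simp add: tate_map_class B.tate_class_eq_iff)
      then show "tate_class B \<beta> k b \<in> tate_map B \<beta> k f ` carrier (tate_H A \<alpha> k)"
        using a(1) by (auto simp: A.carrier_tate_H)
    qed
  qed
  ultimately show ?thesis
    by (simp add: iso_def bij_betw_def)
qed

end

section \<open>Dimension shifting along an exponential sequence\<close>

text \<open>
  An exact sequence \<open>0 \<rightarrow> X \<rightarrow> W \<rightarrow> T \<rightarrow> 0\<close> with uniquely 2-divisible \<open>W\<close>. Its first map is given as the
  double of a homomorphism \<open>\<iota>\<close>, the model being multiplication by \<open>\<pi>i\<close>, because it is the half
  period \<open>\<iota> x\<close>, and not the period, that \<open>E\<close> sends to \<open>ev x\<close>. The minus sign in \<open>\<sigma>_\<iota>\<close> is the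
  sign twist of the periods that offsets the degree shift of the connecting map. The module \<open>W\<close>
  is a subset of an additive group, so that it can be a space of finite sequences of a length
  that is not fixed by a type.
\<close>

locale exponential_sequence =
  conjugation_hom X \<alpha> T \<beta> ev
  for X :: "('x, 'c) monoid_scheme" and \<alpha> and T :: "('t, 'd) monoid_scheme" and \<beta> and ev +
  fixes W :: "'w::ab_group_add set" and \<sigma> :: "'w \<Rightarrow> 'w" and E :: "'w \<Rightarrow> 't" and \<iota> :: "'x \<Rightarrow> 'w"
  assumes W_add: "\<lbrakk>v \<in> W; w \<in> W\<rbrakk> \<Longrightarrow> v + w \<in> W"
    and W_uminus: "w \<in> W \<Longrightarrow> - w \<in> W"
    and W_half: "w \<in> W \<Longrightarrow> \<exists>h\<in>W. h + h = w"
    and W_torsion_free: "\<lbrakk>w \<in> W; w + w = 0\<rbrakk> \<Longrightarrow> w = 0"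
    and \<sigma>_W: "w \<in> W \<Longrightarrow> \<sigma> w \<in> W"
    and \<sigma>_add: "\<lbrakk>v \<in> W; w \<in> W\<rbrakk> \<Longrightarrow> \<sigma> (v + w) = \<sigma> v + \<sigma> w"
    and \<sigma>_\<sigma>: "w \<in> W \<Longrightarrow> \<sigma> (\<sigma> w) = w"
    and \<iota>_W: "x \<in> carrier X \<Longrightarrow> \<iota> x \<in> W"
    and \<iota>_mult: "\<lbrakk>x \<in> carrier X; y \<in> carrier X\<rbrakk> \<Longrightarrow> \<iota> (x \<otimes>\<^bsub>X\<^esub> y) = \<iota> x + \<iota> y"
    and \<iota>_inj: "inj_on \<iota> (carrier X)"
    and \<sigma>_\<iota>: "x \<in> carrier X \<Longrightarrow> \<sigma> (\<iota> x) = - \<iota> (\<alpha> x)"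
    and E_add: "\<lbrakk>v \<in> W; w \<in> W\<rbrakk> \<Longrightarrow> E (v + w) = E v \<otimes>\<^bsub>T\<^esub> E w"
    and E_onto: "E ` W = carrier T"
    and E_\<sigma>: "w \<in> W \<Longrightarrow> E (\<sigma> w) = \<beta> (E w)"
    and E_kernel: "\<lbrakk>w \<in> W; E w = \<one>\<^bsub>T\<^esub>\<rbrakk> \<Longrightarrow> \<exists>x\<in>carrier X. w = \<iota> x + \<iota> x"
    and E_\<iota>: "x \<in> carrier X \<Longrightarrow> E (\<iota> x) = ev x"
begin

lemma W_diff: "\<lbrakk>v \<in> W; w \<in> W\<rbrakk> \<Longrightarrow> v - w \<in> W"
  using W_add[OF _ W_uminus] by (metis diff_conv_add_uminus)

lemma W_zero: "0 \<in> W"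
  using \<iota>_W[of "\<one>\<^bsub>X\<^esub>"] W_diff by fastforce

lemma W_double_cancel:
  assumes "v \<in> W" "w \<in> W" "v + v = w + w"
  shows "v = w"
  using W_torsion_free[of "v - w"] assms W_diff by (simp add: algebra_simps)

lemma E_closed: "w \<in> W \<Longrightarrow> E w \<in> carrier T"
  using E_onto by blast

lemma E_zero: "E 0 = \<one>\<^bsub>T\<^esub>"
  using E_add[of 0 0] E_closed W_zero by (metis B.r_cancel_one' add.right_neutral)

lemma E_uminus: "w \<in> W \<Longrightarrow> E (- w) = inv\<^bsub>T\<^esub> E w"
  using E_add[of "- w" w] W_uminus E_closed E_zero B.inv_equality by (metis ab_left_minus)

lemma \<sigma>_uminus: "w \<in> W \<Longrightarrow> \<sigma> (- w) = - \<sigma> w"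
proof -
  assume w: "w \<in> W"
  have "\<sigma> 0 = 0" using \<sigma>_add[of 0 0] W_zero by simp
  then show ?thesis
    using \<sigma>_add[of "- w" w] W_uminus w by (metis ab_left_minus eq_neg_iff_add_eq_0)
qed

lemma \<iota>_inv: "x \<in> carrier X \<Longrightarrow> \<iota> (inv\<^bsub>X\<^esub> x) = - \<iota> x"
proof -
  assume x: "x \<in> carrier X"
  have "\<iota> \<one>\<^bsub>X\<^esub> = 0" using \<iota>_mult[of "\<one>\<^bsub>X\<^esub>" "\<one>\<^bsub>X\<^esub>"] by simp
  then show ?thesis
    using \<iota>_mult[of "inv\<^bsub>X\<^esub> x" x] x by (simp add: eq_neg_iff_add_eq_0)
qed

text \<open>The additive counterpart on \<open>W\<close> of the power with exponent \<open>alt_sign k\<close>.\<close>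

definition sgn_smult :: "int \<Rightarrow> 'w \<Rightarrow> 'w" where
  "sgn_smult k w = (if even k then w else - w)"

lemma sgn_W: "w \<in> W \<Longrightarrow> sgn_smult k w \<in> W"
  by (simp add: sgn_smult_def W_uminus)

lemma sgn_add: "sgn_smult k (v + w) = sgn_smult k v + sgn_smult k w"
  by (simp add: sgn_smult_def)

lemma sgn_diff: "sgn_smult k (v - w) = sgn_smult k v - sgn_smult k w"
  by (simp add: sgn_smult_def)

lemma sgn_sgn: "sgn_smult k (sgn_smult k w) = w"
  by (simp add: sgn_smult_def)

lemma sgn_uminus: "sgn_smult k (- w) = - sgn_smult k w"
  by (simp add: sgn_smult_def)

lemma \<sigma>_sgn: "w \<in> W \<Longrightarrow> \<sigma> (sgn_smult k w) = sgn_smult k (\<sigma> w)"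
  by (simp add: sgn_smult_def \<sigma>_uminus)

lemma E_diff: "\<lbrakk>v \<in> W; w \<in> W\<rbrakk> \<Longrightarrow> E (v - w) = E v \<otimes>\<^bsub>T\<^esub> inv\<^bsub>T\<^esub> E w"
  using E_add[of v "- w"] E_uminus W_uminus by simp

lemma E_sgn: "w \<in> W \<Longrightarrow> E (sgn_smult k w) = E w [^]\<^bsub>T\<^esub> alt_sign k"
  by (simp add: sgn_smult_def alt_sign_def E_uminus E_closed B.int_pow_neg)

lemma \<iota>_sgn: "x \<in> carrier X \<Longrightarrow> \<iota> (x [^]\<^bsub>X\<^esub> alt_sign k) = sgn_smult k (\<iota> x)"
  by (simp add: sgn_smult_def alt_sign_def \<iota>_inv A.int_pow_neg)

lemma kernel_difference:
  assumes "v \<in> W" "w \<in> W" "E v = E w"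
  obtains x where "x \<in> carrier X" "v = w + (\<iota> x + \<iota> x)"
proof -
  have "E (v - w) = \<one>\<^bsub>T\<^esub>"
    using assms E_closed by (simp add: E_diff)
  with E_kernel W_diff assms obtain x where "x \<in> carrier X" "v - w = \<iota> x + \<iota> x"
    by blast
  with that show thesis by (simp add: algebra_simps)
qed

text \<open>
  Surjectivity on cohomology. A lift \<open>w\<close> of a cocycle \<open>t\<close> satisfies the cocycle condition up to a
  period, and this period is the cocycle of \<open>X\<close> that represents \<open>t\<close>; the vector that bounds the
  difference is half of \<open>w\<close>, up to sign.
\<close>

lemma cocycle_is_coboundary_times_ev:
  assumes t: "t \<in> tate_Z T \<beta> k"
  shows "\<exists>x\<in>tate_Z X \<alpha> k. \<exists>c\<in>tate_B T \<beta> k. t = c \<otimes>\<^bsub>T\<^esub> ev x"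
proof -
  obtain w where w: "w \<in> W" "t = E w"
    using t E_onto by (auto simp: tate_Z_def)
  have "E (\<sigma> w) = E (sgn_smult k w)"
    using t w by (simp add: tate_Z_def E_\<sigma> E_sgn)
  then obtain n where n: "n \<in> carrier X" and \<sigma>w: "\<sigma> w = sgn_smult k w + (\<iota> n + \<iota> n)"
    using kernel_difference w(1) \<sigma>_W sgn_W by metis
  \<comment> \<open>Computing \<open>\<sigma> (\<sigma> w)\<close> from this formula shows that the period is a cocycle.\<close>
  have "w = \<sigma> (sgn_smult k w + (\<iota> n + \<iota> n))"
    using \<sigma>_\<sigma>[OF w(1)] \<sigma>w by simp
  also have "\<dots> = sgn_smult k (sgn_smult k w + (\<iota> n + \<iota> n)) - (\<iota> (\<alpha> n) + \<iota> (\<alpha> n))"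
    using w(1) n by (simp add: \<sigma>_add W_add sgn_W \<iota>_W \<sigma>_sgn \<sigma>_\<iota> \<sigma>w)
  finally have "\<iota> (\<alpha> n) + \<iota> (\<alpha> n) = sgn_smult k (\<iota> n) + sgn_smult k (\<iota> n)"
    by (simp add: sgn_add sgn_sgn algebra_simps)
  then have "\<iota> (\<alpha> n) = \<iota> (n [^]\<^bsub>X\<^esub> alt_sign k)"
    using n by (simp add: W_double_cancel \<iota>_W sgn_W \<iota>_sgn)
  then have "\<alpha> n = n [^]\<^bsub>X\<^esub> alt_sign k"
    using n inj_onD[OF \<iota>_inj] by simp
  then have n_cocycle: "inv\<^bsub>X\<^esub> (n [^]\<^bsub>X\<^esub> alt_sign k) \<in> tate_Z X \<alpha> k"
    using n by (simp add: tate_Z_def A.conj_alt_pow A.int_pow_inv)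
  \<comment> \<open>The coboundary of \<open>h = \<plusminus>w/2\<close> is \<open>w\<close>, up to half of the period, which \<open>E\<close> sends to a value of \<open>ev\<close>.\<close>
  obtain h where h: "h \<in> W" "h + h = sgn_smult k w"
    using W_half sgn_W w(1) by metis
  have hh: "\<sigma> h + \<sigma> h = w + sgn_smult k (\<iota> n + \<iota> n)"
    using \<sigma>_add[OF h(1) h(1)] h(2) w(1) by (simp add: \<sigma>_sgn \<sigma>w sgn_add sgn_sgn)
  have hh': "sgn_smult k h + sgn_smult k h = w"
    using sgn_add[of k h h] h(2) by (simp add: sgn_sgn)
  have "\<sigma> h + sgn_smult k h = w + sgn_smult k (\<iota> n)"
  proof (rule W_double_cancel)
    have "(\<sigma> h + sgn_smult k h) + (\<sigma> h + sgn_smult k h)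
        = (\<sigma> h + \<sigma> h) + (sgn_smult k h + sgn_smult k h)"
      by (simp add: algebra_simps)
    also have "\<dots> = (w + sgn_smult k (\<iota> n)) + (w + sgn_smult k (\<iota> n))"
      unfolding hh hh' by (simp add: sgn_add algebra_simps)
    finally show "(\<sigma> h + sgn_smult k h) + (\<sigma> h + sgn_smult k h)
        = (w + sgn_smult k (\<iota> n)) + (w + sgn_smult k (\<iota> n))" .
  qed (use h(1) w(1) n in \<open>simp_all add: W_add \<sigma>_W sgn_W \<iota>_W\<close>)
  then have "w = (\<sigma> h + sgn_smult k h) + \<iota> (inv\<^bsub>X\<^esub> (n [^]\<^bsub>X\<^esub> alt_sign k))"
    using n by (simp add: \<iota>_inv \<iota>_sgn)
  then have "t = (\<beta> (E h) \<otimes>\<^bsub>T\<^esub> E h [^]\<^bsub>T\<^esub> alt_sign k) \<otimes>\<^bsub>T\<^esub> ev (inv\<^bsub>X\<^esub> (n [^]\<^bsub>X\<^esub> alt_sign k))"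
    using w(2) h(1) n
    by (metis E_\<iota> E_add E_\<sigma> E_sgn \<iota>_W \<sigma>_W sgn_W W_add A.inv_closed A.int_pow_closed)
  moreover have "\<beta> (E h) \<otimes>\<^bsub>T\<^esub> E h [^]\<^bsub>T\<^esub> alt_sign k \<in> tate_B T \<beta> k"
    using E_closed[OF h(1)] by (auto simp: tate_B_def)
  ultimately show ?thesis
    using n_cocycle by blast
qed

text \<open>
  Injectivity on cohomology. Let \<open>\<iota> x\<close> differ from a coboundary \<open>b\<close> of \<open>W\<close> by a period \<open>2 \<iota> m\<close>.
  Since \<open>\<sigma>\<close> acts on \<open>b\<close> by \<open>(-1)\<^sup>k\<close> and on \<open>\<iota> x\<close> by the opposite sign, applying \<open>\<sigma>\<close> gives a
  second expression for \<open>\<iota> x\<close>, in which \<open>b\<close> occurs negatively. The sum of the two expressions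
  does not contain \<open>b\<close>.
\<close>

lemma coboundary_if_ev_coboundary:
  assumes x: "x \<in> tate_Z X \<alpha> k" and ev_x: "ev x \<in> tate_B T \<beta> k"
  shows "x \<in> tate_B X \<alpha> k"
proof -
  have xX: "x \<in> carrier X" and \<alpha>x: "\<alpha> x = x [^]\<^bsub>X\<^esub> alt_sign k"
    using x by (auto simp: tate_Z_def)
  obtain t where t: "t \<in> carrier T" "ev x = \<beta> t \<otimes>\<^bsub>T\<^esub> t [^]\<^bsub>T\<^esub> alt_sign k"
    using ev_x by (auto simp: tate_B_def)
  moreover obtain w where "w \<in> W" "t = E w"
    using t(1) E_onto by blast
  ultimately have w: "w \<in> W" "ev x = \<beta> (E w) \<otimes>\<^bsub>T\<^esub> E w [^]\<^bsub>T\<^esub> alt_sign k"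
    by simp_all
  define b where "b = \<sigma> w + sgn_smult k w"
  have b: "b \<in> W" "\<sigma> b = sgn_smult k b"
    using w(1) by (simp_all add: b_def W_add \<sigma>_W sgn_W \<sigma>_add \<sigma>_\<sigma> \<sigma>_sgn sgn_add sgn_sgn)
  have "E (\<iota> x) = E b"
    using w xX by (simp add: b_def E_\<iota> E_add E_\<sigma> E_sgn \<sigma>_W sgn_W)
  then obtain m where m: "m \<in> carrier X" and \<iota>x: "\<iota> x = b + (\<iota> m + \<iota> m)"
    using kernel_difference b(1) \<iota>_W xX by metis
  have "- sgn_smult k (\<iota> x) = sgn_smult k b - (\<iota> (\<alpha> m) + \<iota> (\<alpha> m))"
    using arg_cong[OF \<iota>x, of \<sigma>] xX m b
    by (simp add: \<sigma>_\<iota> \<alpha>x \<iota>_sgn \<sigma>_add W_add \<iota>_W)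
  from arg_cong[OF this, of "sgn_smult k"]
  have "- \<iota> x = b - (sgn_smult k (\<iota> (\<alpha> m)) + sgn_smult k (\<iota> (\<alpha> m)))"
    by (simp add: sgn_uminus sgn_diff sgn_add sgn_sgn)
  then have "\<iota> x = (sgn_smult k (\<iota> (\<alpha> m)) + sgn_smult k (\<iota> (\<alpha> m))) - b"
    by (metis minus_diff_eq minus_minus)
  then have "\<iota> x + \<iota> x =
      ((sgn_smult k (\<iota> (\<alpha> m)) + sgn_smult k (\<iota> (\<alpha> m))) - b) + (b + (\<iota> m + \<iota> m))"
    using \<iota>x by metis
  also have "\<dots> = (sgn_smult k (\<iota> (\<alpha> m)) + \<iota> m) + (sgn_smult k (\<iota> (\<alpha> m)) + \<iota> m)"
    by (simp add: algebra_simps)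
  finally have "\<iota> x + \<iota> x =
      (sgn_smult k (\<iota> (\<alpha> m)) + \<iota> m) + (sgn_smult k (\<iota> (\<alpha> m)) + \<iota> m)" .
  then have "\<iota> x = sgn_smult k (\<iota> (\<alpha> m)) + \<iota> m"
    by (rule W_double_cancel[rotated 2]) (use xX m in \<open>simp_all add: W_add sgn_W \<iota>_W\<close>)
  also have "\<dots> = \<iota> (\<alpha> (m [^]\<^bsub>X\<^esub> alt_sign k) \<otimes>\<^bsub>X\<^esub> (m [^]\<^bsub>X\<^esub> alt_sign k) [^]\<^bsub>X\<^esub> alt_sign k)"
    using m by (simp add: \<iota>_mult \<iota>_sgn A.conj_alt_pow sgn_sgn)
  finally have "x = \<alpha> (m [^]\<^bsub>X\<^esub> alt_sign k) \<otimes>\<^bsub>X\<^esub> (m [^]\<^bsub>X\<^esub> alt_sign k) [^]\<^bsub>X\<^esub> alt_sign k"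
    by (rule inj_onD[OF \<iota>_inj]) (use xX m in simp_all)
  moreover have "\<dots> \<in> tate_B X \<alpha> k"
    using m by (intro A.coboundaryI) simp
  ultimately show ?thesis
    by metis
qed

end

section \<open>Function algebras and the characters of the multiplicative group\<close>

lemma function_algebra_extensional:
  "u \<in> function_algebra K X F \<Longrightarrow> u \<in> extensional X"
  by (induction rule: function_algebra.induct) (rule restrict_extensional)+

text \<open>
  Composition with \<open>\<phi>\<close> is an algebra homomorphism, so that regularity of a map has to be tested on
  algebra generators only.
\<close>

lemma function_algebra_pullback:
  assumes u: "u \<in> function_algebra K Y F"
    and \<phi>: "\<phi> \<in> X \<rightarrow> Y"
    and gens: "\<And>f. f \<in> F \<Longrightarrow> (\<lambda>x\<in>X. f (\<phi> x)) \<in> function_algebra K X G"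
  shows "(\<lambda>x\<in>X. u (\<phi> x)) \<in> function_algebra K X G"
  using u
proof (induction rule: function_algebra.induct)
  case (const c)
  have eq: "(\<lambda>x\<in>X. (\<lambda>y\<in>Y. c) (\<phi> x)) = (\<lambda>x\<in>X. c)"
    using \<phi> by (intro restrict_ext) auto
  show ?case
    unfolding eq using const by (rule function_algebra.const)
next
  case (gen f)
  have eq: "(\<lambda>x\<in>X. restrict f Y (\<phi> x)) = (\<lambda>x\<in>X. f (\<phi> x))"
    using \<phi> by (intro restrict_ext) auto
  show ?case
    unfolding eq using gen by (rule gens)
next
  case (add f g)
  have eq: "(\<lambda>x\<in>X. (\<lambda>y\<in>Y. f y + g y) (\<phi> x)) = (\<lambda>x\<in>X. (\<lambda>x\<in>X. f (\<phi> x)) x + (\<lambda>x\<in>X. g (\<phi> x)) x)"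
    using \<phi> by (intro restrict_ext) auto
  show ?case
    unfolding eq using add.IH by (rule function_algebra.add)
next
  case (mult f g)
  have eq: "(\<lambda>x\<in>X. (\<lambda>y\<in>Y. f y * g y) (\<phi> x)) = (\<lambda>x\<in>X. (\<lambda>x\<in>X. f (\<phi> x)) x * (\<lambda>x\<in>X. g (\<phi> x)) x)"
    using \<phi> by (intro restrict_ext) auto
  show ?case
    unfolding eq using mult.IH by (rule function_algebra.mult)
qed

lemma carrier_Gm: "carrier Gm = UNIV - {0}"
  and mult_Gm: "x \<otimes>\<^bsub>Gm\<^esub> y = x * y"
  and one_Gm: "\<one>\<^bsub>Gm\<^esub> = 1"
  and coord_ring_Gm: "coord_ring Gm = function_algebra UNIV (carrier Gm) {\<lambda>z. z, inverse}"
  by (simp_all add: Gm_def)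

lemma
  shows carrier_Gm_power: "carrier (Gm_power r) = {..<r} \<rightarrow>\<^sub>E carrier Gm"
    and mult_Gm_power: "s \<otimes>\<^bsub>Gm_power r\<^esub> t = (\<lambda>i\<in>{..<r}. s i * t i)"
    and coord_ring_Gm_power: "coord_ring (Gm_power r) = function_algebra UNIV (carrier (Gm_power r))
         ((\<lambda>i t. t i) ` {..<r} \<union> (\<lambda>i t. inverse (t i)) ` {..<r})"
  by (simp_all add: Gm_power_def Let_def mult_Gm one_Gm)

lemma coord_ring_Gm_Laurent:
  assumes "f \<in> coord_ring Gm"
  obtains p N where "\<And>z. z \<noteq> 0 \<Longrightarrow> f z = poly p z / z ^ N"
proof -
  have "\<exists>p N. \<forall>z. z \<noteq> 0 \<longrightarrow> f z = poly p z / z ^ N"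
    using assms unfolding coord_ring_Gm
  proof (induction rule: function_algebra.induct)
    case (const c)
    show ?case
      by (intro exI[of _ "[:c:]"] exI[of _ 0]) (simp add: carrier_Gm)
  next
    case (gen f)
    then consider "f = (\<lambda>z. z)" | "f = inverse" by auto
    then show ?case
    proof cases
      case 1
      then show ?thesis
        by (intro exI[of _ "[:0, 1:]"] exI[of _ 0]) (simp add: carrier_Gm)
    next
      case 2
      then show ?thesis
        by (intro exI[of _ 1] exI[of _ 1]) (simp add: carrier_Gm field_simps)
    qed
  next
    case (add f g)
    then obtain p N q M where "\<forall>z. z \<noteq> 0 \<longrightarrow> f z = poly p z / z ^ N"
      "\<forall>z. z \<noteq> 0 \<longrightarrow> g z = poly q z / z ^ M"
      by blast
    then show ?case
      by (intro exI[of _ "p * monom 1 M + q * monom 1 N"] exI[of _ "N + M"])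
         (simp add: carrier_Gm poly_monom power_add field_simps)
  next
    case (mult f g)
    then obtain p N q M where "\<forall>z. z \<noteq> 0 \<longrightarrow> f z = poly p z / z ^ N"
      "\<forall>z. z \<noteq> 0 \<longrightarrow> g z = poly q z / z ^ M"
      by blast
    then show ?case
      by (intro exI[of _ "p * q"] exI[of _ "N + M"]) (simp add: carrier_Gm power_add)
  qed
  then show thesis
    using that by blast
qed

text \<open>
  Write the character as a polynomial \<open>p\<close> over a power of \<open>z\<close>. Then \<open>p (z * w) = p z * p w\<close>, and
  comparing the coefficients of \<open>w ^ j\<close> for any \<open>j\<close> with nonzero coefficient in \<open>p\<close> gives
  \<open>p z = z ^ j\<close>.
\<close>

lemma Gm_character_is_power:
  assumes f: "f \<in> coord_ring Gm"
    and mult: "\<And>z w. \<lbrakk>z \<noteq> 0; w \<noteq> 0\<rbrakk> \<Longrightarrow> f (z * w) = f z * f w"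
    and one: "f 1 = 1"
  obtains n :: int where "\<And>z. z \<noteq> 0 \<Longrightarrow> f z = z powi n"
proof -
  obtain p N where p: "\<And>z. z \<noteq> 0 \<Longrightarrow> f z = poly p z / z ^ N"
    using coord_ring_Gm_Laurent[OF f] by blast
  have p_mult: "poly p (z * w) = poly p z * poly p w" if "z \<noteq> 0" "w \<noteq> 0" for z w
    using mult[OF that] that by (simp add: p power_mult_distrib field_simps)
  have "poly p 1 = 1"
    using one p[of 1] by simp
  then have "p \<noteq> 0" by auto
  then obtain j where j: "coeff p j \<noteq> 0"
    by (auto simp: poly_eq_iff)
  have p_power: "poly p z = z ^ j" if z: "z \<noteq> 0" for z
  proof -
    let ?d = "pcompose p [:0, z:] - smult (poly p z) p"
    \<comment> \<open>The identity is known for \<open>w \<noteq> 0\<close> only; the factor \<open>[:0, 1:]\<close> takes care of \<open>w = 0\<close>.\<close>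
    have "poly (?d * [:0, 1:]) w = 0" for w
      using p_mult[OF z, of w] by (cases "w = 0") (simp_all add: poly_pcompose mult.commute)
    then have "?d * [:0, 1:] = 0"
      using poly_all_0_iff_0 by blast
    then have "?d = 0"
      by simp
    then have "coeff (pcompose p [:0, z:]) j = coeff (smult (poly p z) p) j"
      by simp
    then show ?thesis
      using j by (simp add: coeff_pcompose_linear)
  qed
  have "f z = z powi (int j - int N)" if "z \<noteq> 0" for z
    using that by (simp add: p p_power power_int_diff)
  then show thesis
    using that by blast
qed

lemma power_int_in_coord_ring_Gm: "(\<lambda>z\<in>carrier Gm. z powi n) \<in> coord_ring Gm"
proof -
  have pow: "(\<lambda>z\<in>carrier Gm. g z ^ m) \<in> coord_ring Gm"
    if g: "g \<in> {\<lambda>z. z, inverse}" for g and m :: nat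
  proof (induction m)
    case 0
    show ?case
      unfolding coord_ring_Gm power_0 by (rule function_algebra.const) simp
  next
    case (Suc m)
    have "(\<lambda>z\<in>carrier Gm. g z ^ Suc m) =
        (\<lambda>z\<in>carrier Gm. restrict g (carrier Gm) z * (\<lambda>z\<in>carrier Gm. g z ^ m) z)"
      by (intro restrict_ext) auto
    also have "\<dots> \<in> coord_ring Gm"
      using function_algebra.gen[OF g] Suc unfolding coord_ring_Gm
      by (rule function_algebra.mult)
    finally show ?case .
  qed
  show ?thesis
    using pow[of "\<lambda>z. z" "nat n"] pow[of inverse "nat (- n)"]
    by (cases "0 \<le> n") (simp_all add: power_int_def)
qed

text \<open>Conjugating the values and the argument conjugates the coefficients of a Laurent polynomial.\<close>

lemma coord_ring_Gm_cnj:
  assumes "f \<in> coord_ring Gm"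
  shows "(\<lambda>z\<in>carrier Gm. cnj (f (cnj z))) \<in> coord_ring Gm"
  using assms unfolding coord_ring_Gm
proof (induction rule: function_algebra.induct)
  case (const c)
  have eq: "(\<lambda>z\<in>carrier Gm. cnj ((\<lambda>z\<in>carrier Gm. c) (cnj z))) = (\<lambda>z\<in>carrier Gm. cnj c)"
    by (intro restrict_ext) (auto simp: carrier_Gm)
  show ?case
    unfolding eq by (rule function_algebra.const) simp
next
  case (gen f)
  then have eq: "(\<lambda>z\<in>carrier Gm. cnj (restrict f (carrier Gm) (cnj z))) = restrict f (carrier Gm)"
    by (intro restrict_ext) (auto simp: carrier_Gm)
  show ?case
    unfolding eq using gen by (rule function_algebra.gen)
next
  case (add f g)
  have eq: "(\<lambda>z\<in>carrier Gm. cnj ((\<lambda>z\<in>carrier Gm. f z + g z) (cnj z))) =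
      (\<lambda>z\<in>carrier Gm. (\<lambda>z\<in>carrier Gm. cnj (f (cnj z))) z + (\<lambda>z\<in>carrier Gm. cnj (g (cnj z))) z)"
    by (intro restrict_ext) (auto simp: carrier_Gm)
  show ?case
    unfolding eq using add.IH by (rule function_algebra.add)
next
  case (mult f g)
  have eq: "(\<lambda>z\<in>carrier Gm. cnj ((\<lambda>z\<in>carrier Gm. f z * g z) (cnj z))) =
      (\<lambda>z\<in>carrier Gm. (\<lambda>z\<in>carrier Gm. cnj (f (cnj z))) z * (\<lambda>z\<in>carrier Gm. cnj (g (cnj z))) z)"
    by (intro restrict_ext) (auto simp: carrier_Gm)
  show ?case
    unfolding eq using mult.IH by (rule function_algebra.mult)
qed

section \<open>Complex conjugation on points and on cocharacters\<close>

locale real_algebraic_group = affine_algebraic_group \<real> G for G :: "'a affine_grp" (structure)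
begin

lemma coord_ring_generated:
  obtains F where "coord_ring G = function_algebra \<real> (carrier G) F"
  using finitely_generated by blast

lemma coord_ring_extensional: "f \<in> coord_ring G \<Longrightarrow> f \<in> extensional (carrier G)"
  by (rule coord_ring_generated) (simp add: function_algebra_extensional)

text \<open>
  The evaluation at \<open>x\<close> followed by complex conjugation is again a homomorphism of \<open>\<real>\<close>-algebras
  to \<open>\<complex>\<close>, hence the evaluation at a unique point.
\<close>

lemma gal_point_ex1:
  assumes "x \<in> carrier G"
  shows "\<exists>!y. y \<in> carrier G \<and> (\<forall>f\<in>coord_ring G. f y = cnj (f x))"
proof -
  have "algebra_hom_to_complex \<real> (carrier G) (coord_ring G) (\<lambda>f. cnj (f x))"
    using assms by (auto simp: algebra_hom_to_complex_def Reals_cnj_iff)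
  then obtain y where "y \<in> carrier G" "\<forall>f\<in>coord_ring G. cnj (f x) = f y"
    using points_exhaust by blast
  then show ?thesis
    using points_separated by (intro ex1I[of _ y]) auto
qed

lemma gal_point_closed: "x \<in> carrier G \<Longrightarrow> gal_point G x \<in> carrier G"
  and coord_gal_point:
    "\<lbrakk>x \<in> carrier G; f \<in> coord_ring G\<rbrakk> \<Longrightarrow> f (gal_point G x) = cnj (f x)"
  using theI'[OF gal_point_ex1] unfolding gal_point_def by blast+

lemma gal_point_eqI:
  assumes "x \<in> carrier G" "y \<in> carrier G" "\<And>f. f \<in> coord_ring G \<Longrightarrow> f y = cnj (f x)"
  shows "gal_point G x = y"
  using assms by (intro points_separated) (auto simp: gal_point_closed coord_gal_point)

lemma gal_point_involution: "x \<in> carrier G \<Longrightarrow> gal_point G (gal_point G x) = x"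
  by (intro gal_point_eqI) (auto simp: gal_point_closed coord_gal_point)

text \<open>
  The function \<open>(x, y) \<mapsto> f (x \<otimes> y)\<close> is a polynomial with real coefficients in functions of \<open>x\<close> and
  of \<open>y\<close> from the real coordinate ring, and such polynomials commute with conjugation.
\<close>

lemma gal_point_mult:
  assumes "x \<in> carrier G" "y \<in> carrier G"
  shows "gal_point G (x \<otimes> y) = gal_point G x \<otimes> gal_point G y"
proof (rule gal_point_eqI)
  fix f assume f: "f \<in> coord_ring G"
  let ?C = "carrier G \<times> carrier G" and ?\<gamma> = "gal_point G"
  have "u (?\<gamma> x, ?\<gamma> y) = cnj (u (x, y))"
    if "u \<in> function_algebra \<real> ?C
      ((\<lambda>g p. g (fst p)) ` coord_ring G \<union> (\<lambda>g p. g (snd p)) ` coord_ring G)" for u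
    using that
  proof (induction rule: function_algebra.induct)
    case (const c)
    then show ?case
      using assms by (simp add: gal_point_closed Reals_cnj_iff)
  next
    case (gen g)
    then show ?case
      using assms by (auto simp: gal_point_closed coord_gal_point)
  next
    case (add g h)
    show ?case
      using assms add.IH by (simp add: gal_point_closed)
  next
    case (mult g h)
    show ?case
      using assms mult.IH by (simp add: gal_point_closed)
  qed
  from this[OF comult[OF f]] show "f (?\<gamma> x \<otimes> ?\<gamma> y) = cnj (f (x \<otimes> y))"
    using assms by (simp add: gal_point_closed)
qed (use assms in \<open>auto simp: gal_point_closed\<close>)

lemma gal_point_hom: "gal_point G \<in> hom G G"
  by (simp add: hom_def gal_point_closed gal_point_mult)

lemma base_change_simps [simp]:
  "carrier (base_change G) = carrier G" "monoid.mult (base_change G) = monoid.mult G"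
  "one (base_change G) = one G"
  "coord_ring (base_change G) = function_algebra UNIV (carrier G) (coord_ring G)"
  by (simp_all add: base_change_def)

lemma coord_ring_base_change:
  assumes f: "f \<in> coord_ring G"
  shows "f \<in> coord_ring (base_change G)"
proof -
  have eq: "restrict f (carrier G) = f"
    using coord_ring_extensional[OF f] by (rule extensional_restrict)
  show ?thesis
    using function_algebra.gen[OF f, where K = UNIV and X = "carrier G"]
    unfolding base_change_simps eq .
qed

lemma carrier_cochar_group: "carrier (cochar_group G) = alg_group_hom Gm (base_change G)"
  by (simp add: cochar_group_def)

lemma cochar_closed: "\<lbrakk>\<nu> \<in> carrier (cochar_group G); z \<noteq> 0\<rbrakk> \<Longrightarrow> \<nu> z \<in> carrier G"
  by (auto simp: carrier_cochar_group alg_group_hom_def hom_def carrier_Gm)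

lemma cochar_mult:
  "\<lbrakk>\<nu> \<in> carrier (cochar_group G); z \<noteq> 0; w \<noteq> 0\<rbrakk> \<Longrightarrow> \<nu> (z * w) = \<nu> z \<otimes> \<nu> w"
  by (auto simp: carrier_cochar_group alg_group_hom_def hom_def carrier_Gm mult_Gm)

lemma cochar_extensional: "\<nu> \<in> carrier (cochar_group G) \<Longrightarrow> \<nu> \<in> extensional (carrier Gm)"
  by (auto simp: carrier_cochar_group alg_group_hom_def)

lemma cochar_pullback:
  "\<lbrakk>\<nu> \<in> carrier (cochar_group G); f \<in> coord_ring (base_change G)\<rbrakk>
    \<Longrightarrow> (\<lambda>z\<in>carrier Gm. f (\<nu> z)) \<in> coord_ring Gm"
  unfolding carrier_cochar_group alg_group_hom_def by blast

lemma gal_cochar_apply: "z \<noteq> 0 \<Longrightarrow> gal_cochar G \<nu> z = gal_point G (\<nu> (cnj z))"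
  by (simp add: gal_cochar_def carrier_Gm)

text \<open>
  Regularity needs to be checked on real coordinate functions \<open>g\<close> only, and there
  \<open>g (gal_cochar G \<nu> z) = cnj (g (\<nu> (cnj z)))\<close>.
\<close>

lemma gal_cochar_closed:
  assumes \<nu>: "\<nu> \<in> carrier (cochar_group G)"
  shows "gal_cochar G \<nu> \<in> carrier (cochar_group G)"
proof -
  have "gal_cochar G \<nu> \<in> hom Gm (base_change G)"
    using \<nu> by (intro homI)
      (auto simp: carrier_Gm mult_Gm gal_cochar_apply gal_point_closed cochar_closed cochar_mult
        gal_point_mult)
  moreover have "gal_cochar G \<nu> \<in> extensional (carrier Gm)"
    by (simp add: gal_cochar_def)
  moreover have "(\<lambda>z\<in>carrier Gm. f (gal_cochar G \<nu> z)) \<in> coord_ring Gm"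
    if f: "f \<in> coord_ring (base_change G)" for f
    unfolding coord_ring_Gm
  proof (rule function_algebra_pullback[where u = f and \<phi> = "gal_cochar G \<nu>"])
    show "f \<in> function_algebra UNIV (carrier G) (coord_ring G)"
      using f by simp
    show "gal_cochar G \<nu> \<in> carrier Gm \<rightarrow> carrier G"
      using \<nu> by (auto simp: carrier_Gm gal_cochar_apply gal_point_closed cochar_closed)
  next
    fix g assume g: "g \<in> coord_ring G"
    have "(\<lambda>z\<in>carrier Gm. cnj ((\<lambda>z\<in>carrier Gm. g (\<nu> z)) (cnj z))) \<in> coord_ring Gm"
      using coord_ring_Gm_cnj[OF cochar_pullback[OF \<nu> coord_ring_base_change[OF g]]] .
    moreover have "(\<lambda>z\<in>carrier Gm. cnj ((\<lambda>z\<in>carrier Gm. g (\<nu> z)) (cnj z))) =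
        (\<lambda>z\<in>carrier Gm. g (gal_cochar G \<nu> z))"
      using g \<nu> by (intro restrict_ext)
        (simp add: carrier_Gm gal_cochar_apply coord_gal_point cochar_closed)
    ultimately show "(\<lambda>z\<in>carrier Gm. g (gal_cochar G \<nu> z)) \<in>
        function_algebra UNIV (carrier Gm) {\<lambda>z. z, inverse}"
      unfolding coord_ring_Gm by metis
  qed
  ultimately show ?thesis
    unfolding carrier_cochar_group alg_group_hom_def by blast
qed

end

section \<open>Cocharacters of a torus in coordinates\<close>

lemma power_int_two_inject: "(2::complex) powi m = 2 powi n \<Longrightarrow> m = n"
proof -
  assume "(2::complex) powi m = 2 powi n"
  then have "norm ((2::complex) powi m) = norm ((2::complex) powi n)"
    by simp
  then have "(2::real) powi m = 2 powi n"
    by (simp add: norm_power_int)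
  then show "m = n"
    using power_int_strict_increasing[of m n "2::real"] power_int_strict_increasing[of n m "2::real"]
    by (cases m n rule: linorder_cases) auto
qed

locale trivialized_torus = real_algebraic_group T for T :: "'a affine_grp" (structure) +
  fixes r :: nat and \<phi> :: "'a \<Rightarrow> nat \<Rightarrow> complex" and \<psi> :: "(nat \<Rightarrow> complex) \<Rightarrow> 'a"
  assumes \<phi>_hom: "\<phi> \<in> alg_group_hom (base_change T) (Gm_power r)"
    and \<psi>_hom: "\<psi> \<in> alg_group_hom (Gm_power r) (base_change T)"
    and \<psi>_\<phi>: "x \<in> carrier T \<Longrightarrow> \<psi> (\<phi> x) = x"
    and \<phi>_\<psi>: "t \<in> carrier (Gm_power r) \<Longrightarrow> \<phi> (\<psi> t) = t"
begin

abbreviation X where "X \<equiv> cochar_group T"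
abbreviation \<gamma> where "\<gamma> \<equiv> gal_point T"

lemma \<phi>_closed: "x \<in> carrier T \<Longrightarrow> \<phi> x \<in> carrier (Gm_power r)"
  using \<phi>_hom by (auto simp: alg_group_hom_def hom_def)

lemma \<psi>_closed: "t \<in> carrier (Gm_power r) \<Longrightarrow> \<psi> t \<in> carrier T"
  using \<psi>_hom by (auto simp: alg_group_hom_def hom_def)

lemma \<phi>_nonzero: "\<lbrakk>x \<in> carrier T; i < r\<rbrakk> \<Longrightarrow> \<phi> x i \<noteq> 0"
  using \<phi>_closed[of x] by (auto simp: carrier_Gm_power carrier_Gm PiE_iff)

lemma \<phi>_mult:
  assumes "x \<in> carrier T" "y \<in> carrier T" "i < r"
  shows "\<phi> (x \<otimes> y) i = \<phi> x i * \<phi> y i"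
proof -
  have "\<phi> (x \<otimes> y) = \<phi> x \<otimes>\<^bsub>Gm_power r\<^esub> \<phi> y"
    using \<phi>_hom assms by (simp add: alg_group_hom_def hom_def)
  then show ?thesis
    using assms by (simp add: mult_Gm_power)
qed

lemma \<phi>_one: "i < r \<Longrightarrow> \<phi> \<one> i = 1"
  using \<phi>_mult[of \<one> \<one> i] \<phi>_nonzero[of \<one> i] by simp

lemma \<phi>_eqI:
  assumes "x \<in> carrier T" "y \<in> carrier T" "\<And>i. i < r \<Longrightarrow> \<phi> x i = \<phi> y i"
  shows "x = y"
proof -
  have "\<phi> x = \<phi> y"
    using \<phi>_closed[OF assms(1)] \<phi>_closed[OF assms(2)] assms(3)
    unfolding carrier_Gm_power by (intro PiE_ext) auto
  then show ?thesis
    using \<psi>_\<phi> assms(1,2) by metis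
qed

lemma torus_comm: "\<lbrakk>x \<in> carrier T; y \<in> carrier T\<rbrakk> \<Longrightarrow> x \<otimes> y = y \<otimes> x"
  by (rule \<phi>_eqI) (auto simp: \<phi>_mult)

text \<open>Each coordinate of a cocharacter is a regular character of the multiplicative group.\<close>

lemma cochar_coordinate:
  assumes \<nu>: "\<nu> \<in> carrier X" and i: "i < r"
  shows "\<exists>n::int. \<forall>z. z \<noteq> 0 \<longrightarrow> \<phi> (\<nu> z) i = z powi n"
proof -
  let ?C = "carrier (Gm_power r)"
  have "(\<lambda>t\<in>?C. t i) \<in> coord_ring (Gm_power r)"
    unfolding coord_ring_Gm_power by (rule function_algebra.gen) (use i in auto)
  then have "(\<lambda>x\<in>carrier (base_change T). (\<lambda>t\<in>?C. t i) (\<phi> x)) \<in> coord_ring (base_change T)"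
    using \<phi>_hom unfolding alg_group_hom_def by blast
  moreover have "(\<lambda>x\<in>carrier (base_change T). (\<lambda>t\<in>?C. t i) (\<phi> x)) = (\<lambda>x\<in>carrier T. \<phi> x i)"
    unfolding base_change_simps by (intro restrict_ext) (simp add: \<phi>_closed)
  ultimately have "(\<lambda>x\<in>carrier T. \<phi> x i) \<in> coord_ring (base_change T)"
    by metis
  from cochar_pullback[OF \<nu> this]
  have f: "(\<lambda>z\<in>carrier Gm. (\<lambda>x\<in>carrier T. \<phi> x i) (\<nu> z)) \<in> coord_ring Gm" (is "?f \<in> _") .
  have f_eq: "?f z = \<phi> (\<nu> z) i" if "z \<noteq> 0" for z
    using that \<nu> by (simp add: carrier_Gm cochar_closed)
  have \<nu>_one: "\<nu> 1 = \<one>"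
    using cochar_mult[OF \<nu>, of 1 1] cochar_closed[OF \<nu>, of 1] by simp
  obtain n :: int where "\<And>z. z \<noteq> 0 \<Longrightarrow> ?f z = z powi n"
  proof (rule Gm_character_is_power[OF f])
    show "?f (z * w) = ?f z * ?f w" if "z \<noteq> 0" "w \<noteq> 0" for z w
      using that \<nu> i by (simp add: f_eq cochar_mult \<phi>_mult cochar_closed del: restrict_apply)
    show "?f 1 = 1"
      using i by (simp add: f_eq \<nu>_one \<phi>_one del: restrict_apply)
  qed blast
  then show ?thesis
    using f_eq by metis
qed

definition weight :: "(complex \<Rightarrow> 'a) \<Rightarrow> nat \<Rightarrow> int" where
  "weight \<nu> i = (SOME n. \<forall>z. z \<noteq> 0 \<longrightarrow> \<phi> (\<nu> z) i = z powi n)"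

lemma \<phi>_cochar:
  "\<lbrakk>\<nu> \<in> carrier X; i < r; z \<noteq> 0\<rbrakk> \<Longrightarrow> \<phi> (\<nu> z) i = z powi weight \<nu> i"
  using someI_ex[OF cochar_coordinate] unfolding weight_def by blast

text \<open>The powers of 2 are distinct, so a single point determines the weight.\<close>

lemma weight_eqI:
  assumes "\<nu> \<in> carrier X" "i < r" "\<phi> (\<nu> 2) i = 2 powi n"
  shows "weight \<nu> i = n"
  using assms \<phi>_cochar[of \<nu> i 2] by (intro power_int_two_inject) simp

definition cochar_of :: "(nat \<Rightarrow> int) \<Rightarrow> complex \<Rightarrow> 'a" where
  "cochar_of n = (\<lambda>z\<in>carrier Gm. \<psi> (\<lambda>i\<in>{..<r}. z powi n i))"

lemma powers_closed: "z \<noteq> 0 \<Longrightarrow> (\<lambda>i\<in>{..<r}. z powi n i) \<in> carrier (Gm_power r)"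
  by (auto simp: carrier_Gm_power carrier_Gm)

lemma \<phi>_cochar_of: "\<lbrakk>z \<noteq> 0; i < r\<rbrakk> \<Longrightarrow> \<phi> (cochar_of n z) i = z powi n i"
  by (simp add: cochar_of_def carrier_Gm \<phi>_\<psi> powers_closed)

lemma cochar_of_point_closed: "z \<noteq> 0 \<Longrightarrow> cochar_of n z \<in> carrier T"
  by (simp add: cochar_of_def carrier_Gm \<psi>_closed powers_closed)

lemma cochar_of_closed: "cochar_of n \<in> carrier X"
proof -
  have "cochar_of n \<in> hom Gm (base_change T)"
  proof (rule homI)
    fix z w assume zw: "z \<in> carrier Gm" "w \<in> carrier Gm"
    then show "cochar_of n (z \<otimes>\<^bsub>Gm\<^esub> w) = cochar_of n z \<otimes>\<^bsub>base_change T\<^esub> cochar_of n w"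
      by (intro \<phi>_eqI)
        (auto simp: carrier_Gm mult_Gm cochar_of_point_closed \<phi>_mult \<phi>_cochar_of power_int_mult_distrib)
  qed (simp add: carrier_Gm cochar_of_point_closed)
  moreover have "cochar_of n \<in> extensional (carrier Gm)"
    by (simp add: cochar_of_def)
  moreover have "(\<lambda>z\<in>carrier Gm. f (cochar_of n z)) \<in> coord_ring Gm"
    if f: "f \<in> coord_ring (base_change T)" for f
  proof -
    let ?t = "\<lambda>z. \<lambda>i\<in>{..<r}. z powi n i" and ?C = "carrier (Gm_power r)"
    have f\<psi>: "(\<lambda>t\<in>?C. f (\<psi> t)) \<in> coord_ring (Gm_power r)"
      using \<psi>_hom f unfolding alg_group_hom_def by blast
    have "(\<lambda>z\<in>carrier Gm. (\<lambda>t\<in>?C. f (\<psi> t)) (?t z)) \<in> coord_ring Gm"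
      unfolding coord_ring_Gm
    proof (rule function_algebra_pullback[where \<phi> = ?t])
      show "(\<lambda>t\<in>?C. f (\<psi> t)) \<in> function_algebra UNIV ?C
          ((\<lambda>i t. t i) ` {..<r} \<union> (\<lambda>i t. inverse (t i)) ` {..<r})"
        using f\<psi> unfolding coord_ring_Gm_power .
      show "?t \<in> carrier Gm \<rightarrow> ?C"
        using powers_closed by (auto simp: carrier_Gm)
    next
      fix g :: "(nat \<Rightarrow> complex) \<Rightarrow> complex"
      assume "g \<in> (\<lambda>i t. t i) ` {..<r} \<union> (\<lambda>i t. inverse (t i)) ` {..<r}"
      then obtain i where i: "i < r" and g: "g = (\<lambda>t. t i) \<or> g = (\<lambda>t. inverse (t i))"
        by auto
      have "(\<lambda>z\<in>carrier Gm. g (?t z)) = (\<lambda>z\<in>carrier Gm. z powi n i) \<or>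
          (\<lambda>z\<in>carrier Gm. g (?t z)) = (\<lambda>z\<in>carrier Gm. z powi (- n i))"
        using g i by (auto simp: power_int_minus)
      then show "(\<lambda>z\<in>carrier Gm. g (?t z)) \<in> function_algebra UNIV (carrier Gm) {\<lambda>z. z, inverse}"
        using power_int_in_coord_ring_Gm unfolding coord_ring_Gm by metis
    qed
    moreover have "(\<lambda>z\<in>carrier Gm. (\<lambda>t\<in>?C. f (\<psi> t)) (?t z)) = (\<lambda>z\<in>carrier Gm. f (cochar_of n z))"
      using powers_closed by (intro restrict_ext) (simp add: cochar_of_def carrier_Gm)
    ultimately show ?thesis
      by metis
  qed
  ultimately show ?thesis
    unfolding carrier_cochar_group alg_group_hom_def by blast
qed

lemma weight_cochar_of: "i < r \<Longrightarrow> weight (cochar_of n) i = n i"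
  by (intro weight_eqI cochar_of_closed) (simp_all add: \<phi>_cochar_of)

lemma cochar_eqI:
  assumes "\<mu> \<in> carrier X" "\<nu> \<in> carrier X" "\<And>z. z \<noteq> 0 \<Longrightarrow> \<mu> z = \<nu> z"
  shows "\<mu> = \<nu>"
  using cochar_extensional[OF assms(1)] cochar_extensional[OF assms(2)]
  by (rule extensionalityI) (simp add: assms(3) carrier_Gm)

lemma weight_inject:
  assumes "\<mu> \<in> carrier X" "\<nu> \<in> carrier X" "\<And>i. i < r \<Longrightarrow> weight \<mu> i = weight \<nu> i"
  shows "\<mu> = \<nu>"
  using assms by (intro cochar_eqI \<phi>_eqI) (auto simp: cochar_closed \<phi>_cochar)

lemma cochar_mult_apply: "z \<noteq> 0 \<Longrightarrow> (\<mu> \<otimes>\<^bsub>X\<^esub> \<nu>) z = \<mu> z \<otimes> \<nu> z"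
  and cochar_one_apply: "z \<noteq> 0 \<Longrightarrow> \<one>\<^bsub>X\<^esub> z = \<one>"
  by (simp_all add: cochar_group_def carrier_Gm)

text \<open>
  In coordinates a product of cocharacters is again given by integral powers, which shows that it
  is regular.
\<close>

lemma cochar_mult_closed:
  assumes "\<mu> \<in> carrier X" "\<nu> \<in> carrier X"
  shows "\<mu> \<otimes>\<^bsub>X\<^esub> \<nu> \<in> carrier X"
proof -
  have "\<mu> \<otimes>\<^bsub>X\<^esub> \<nu> = cochar_of (\<lambda>i. weight \<mu> i + weight \<nu> i)"
  proof (rule extensionalityI)
    show "\<mu> \<otimes>\<^bsub>X\<^esub> \<nu> \<in> extensional (carrier Gm)"
      by (simp add: cochar_group_def)
    show "cochar_of (\<lambda>i. weight \<mu> i + weight \<nu> i) \<in> extensional (carrier Gm)"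
      by (simp add: cochar_of_def)
    show "(\<mu> \<otimes>\<^bsub>X\<^esub> \<nu>) z = cochar_of (\<lambda>i. weight \<mu> i + weight \<nu> i) z" if "z \<in> carrier Gm" for z
      using that assms
      by (intro \<phi>_eqI) (auto simp: carrier_Gm cochar_mult_apply cochar_of_point_closed cochar_closed
          \<phi>_mult \<phi>_cochar \<phi>_cochar_of power_int_add)
  qed
  then show ?thesis
    by (simp add: cochar_of_closed)
qed

lemma cochar_one_closed: "\<one>\<^bsub>X\<^esub> \<in> carrier X"
proof -
  have "\<one>\<^bsub>X\<^esub> = cochar_of (\<lambda>i. 0)"
  proof (rule extensionalityI)
    show "\<one>\<^bsub>X\<^esub> \<in> extensional (carrier Gm)"
      by (simp add: cochar_group_def)
    show "cochar_of (\<lambda>i. 0) \<in> extensional (carrier Gm)"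
      by (simp add: cochar_of_def)
    show "\<one>\<^bsub>X\<^esub> z = cochar_of (\<lambda>i. 0) z" if "z \<in> carrier Gm" for z
      using that
      by (intro \<phi>_eqI)
        (auto simp: carrier_Gm cochar_one_apply cochar_of_point_closed \<phi>_one \<phi>_cochar_of)
  qed
  then show ?thesis
    by (simp add: cochar_of_closed)
qed

lemma weight_mult:
  "\<lbrakk>\<mu> \<in> carrier X; \<nu> \<in> carrier X; i < r\<rbrakk> \<Longrightarrow> weight (\<mu> \<otimes>\<^bsub>X\<^esub> \<nu>) i = weight \<mu> i + weight \<nu> i"
  by (intro weight_eqI cochar_mult_closed)
     (simp_all add: cochar_mult_apply \<phi>_mult cochar_closed \<phi>_cochar power_int_add)

lemma comm_group_cochar: "comm_group X"
proof (rule comm_groupI)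
  fix \<mu> \<nu> \<rho> assume "\<mu> \<in> carrier X" "\<nu> \<in> carrier X" "\<rho> \<in> carrier X"
  then show "\<mu> \<otimes>\<^bsub>X\<^esub> \<nu> \<otimes>\<^bsub>X\<^esub> \<rho> = \<mu> \<otimes>\<^bsub>X\<^esub> (\<nu> \<otimes>\<^bsub>X\<^esub> \<rho>)"
    by (intro weight_inject) (simp_all add: cochar_mult_closed weight_mult)
next
  fix \<mu> \<nu> assume "\<mu> \<in> carrier X" "\<nu> \<in> carrier X"
  then show "\<mu> \<otimes>\<^bsub>X\<^esub> \<nu> = \<nu> \<otimes>\<^bsub>X\<^esub> \<mu>"
    by (intro weight_inject) (simp_all add: cochar_mult_closed weight_mult)
next
  fix \<nu> assume \<nu>: "\<nu> \<in> carrier X"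
  then show "\<one>\<^bsub>X\<^esub> \<otimes>\<^bsub>X\<^esub> \<nu> = \<nu>"
    by (intro cochar_eqI)
      (simp_all add: cochar_mult_closed cochar_one_closed cochar_mult_apply cochar_one_apply
        cochar_closed)
  have "cochar_of (\<lambda>i. - weight \<nu> i) \<otimes>\<^bsub>X\<^esub> \<nu> = \<one>\<^bsub>X\<^esub>"
    using \<nu>
    by (intro cochar_eqI \<phi>_eqI)
      (simp_all add: cochar_mult_closed cochar_one_closed cochar_of_closed cochar_mult_apply
        cochar_one_apply cochar_closed cochar_of_point_closed \<phi>_mult \<phi>_one \<phi>_cochar weight_cochar_of
        power_int_minus)
  then show "\<exists>\<mu>\<in>carrier X. \<mu> \<otimes>\<^bsub>X\<^esub> \<nu> = \<one>\<^bsub>X\<^esub>"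
    using cochar_of_closed by blast
qed (auto intro: cochar_mult_closed cochar_one_closed)

lemma gal_cochar_involution: "\<nu> \<in> carrier X \<Longrightarrow> gal_cochar T (gal_cochar T \<nu>) = \<nu>"
  by (rule cochar_eqI)
     (simp_all add: gal_cochar_closed gal_cochar_apply gal_point_involution cochar_closed)

lemma gal_cochar_hom: "gal_cochar T \<in> hom X X"
proof (rule homI)
  fix \<mu> \<nu> assume "\<mu> \<in> carrier X" "\<nu> \<in> carrier X"
  then show "gal_cochar T (\<mu> \<otimes>\<^bsub>X\<^esub> \<nu>) = gal_cochar T \<mu> \<otimes>\<^bsub>X\<^esub> gal_cochar T \<nu>"
    by (intro cochar_eqI)
      (simp_all add: gal_cochar_closed cochar_mult_closed gal_cochar_apply cochar_mult_apply
        gal_point_mult cochar_closed)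
qed (rule gal_cochar_closed)

lemma ev_hom: "ev_minus_one \<in> hom X T"
  by (rule homI) (simp_all add: ev_minus_one_def cochar_closed cochar_mult_apply)

sublocale ev: conjugation_hom X "gal_cochar T" T \<gamma> ev_minus_one
proof -
  interpret X: comm_group X
    by (rule comm_group_cochar)
  interpret T: comm_group T
    by unfold_locales (rule torus_comm)
  show "conjugation_hom X (gal_cochar T) T \<gamma> ev_minus_one"
    by unfold_locales
      (simp_all add: gal_cochar_hom gal_cochar_involution gal_point_hom gal_point_involution ev_hom
        ev_minus_one_def gal_cochar_apply)
qed

section \<open>The exponential sequence of a torus\<close>

definition W :: "(nat \<Rightarrow> complex) set" where
  "W = {w. \<forall>i\<ge>r. w i = 0}"

definition E :: "(nat \<Rightarrow> complex) \<Rightarrow> 'a" where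
  "E w = \<psi> (\<lambda>i\<in>{..<r}. exp (w i))"

definition \<iota> :: "(complex \<Rightarrow> 'a) \<Rightarrow> nat \<Rightarrow> complex" where
  "\<iota> \<nu> = (\<lambda>i. if i < r then \<i> * pi * of_int (weight \<nu> i) else 0)"

definition basis_cochar :: "nat \<Rightarrow> complex \<Rightarrow> 'a" where
  "basis_cochar j = cochar_of (\<lambda>i. if i = j then 1 else 0)"

definition gal_matrix :: "nat \<Rightarrow> nat \<Rightarrow> int" where
  "gal_matrix i j = weight (gal_cochar T (basis_cochar j)) i"

text \<open>
  In the coordinates \<open>W = X \<otimes> \<complex>\<close> this is the action on \<open>X\<close>, given by \<open>gal_matrix\<close>, tensored with
  complex conjugation.
\<close>

definition \<sigma> :: "(nat \<Rightarrow> complex) \<Rightarrow> nat \<Rightarrow> complex" where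
  "\<sigma> w = (\<lambda>i. if i < r then \<Sum>j<r. of_int (gal_matrix i j) * cnj (w j) else 0)"

lemma exp_closed: "(\<lambda>i\<in>{..<r}. exp (w i)) \<in> carrier (Gm_power r)"
  by (auto simp: carrier_Gm_power carrier_Gm)

lemma E_closed: "E w \<in> carrier T"
  by (simp add: E_def \<psi>_closed exp_closed)

lemma \<phi>_E: "i < r \<Longrightarrow> \<phi> (E w) i = exp (w i)"
  by (simp add: E_def \<phi>_\<psi> exp_closed)

lemma E_add: "E (v + w) = E v \<otimes> E w"
  by (rule \<phi>_eqI) (simp_all add: E_closed \<phi>_E \<phi>_mult exp_add)

lemma \<sigma>_add: "\<sigma> (v + w) = \<sigma> v + \<sigma> w"
  by (auto simp: \<sigma>_def fun_eq_iff distrib_left sum.distrib)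

text \<open>
  On the \<open>j\<close>-th axis \<open>E\<close> takes the values \<open>\<nu> (exp c)\<close> for the basis cocharacter \<open>\<nu>\<close>, and
  \<open>\<gamma> (\<nu> (exp c)) = (\<gamma> \<nu>) (exp (cnj c))\<close> by the definition of the action on cocharacters.
\<close>

lemma E_\<sigma>_axis: 
  assumes j: "j < r"
  shows "\<gamma> (E (\<lambda>i. if i = j then c else 0)) = E (\<sigma> (\<lambda>i. if i = j then c else 0))"
proof -
  let ?e = "\<lambda>i. if i = j then c else 0"
  have b: "basis_cochar j \<in> carrier X"
    by (simp add: basis_cochar_def cochar_of_closed)
  have "E ?e = basis_cochar j (exp c)"
    by (rule \<phi>_eqI)
      (auto simp: E_closed basis_cochar_def cochar_of_point_closed \<phi>_E \<phi>_cochar_of)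
  then have "\<gamma> (E ?e) = gal_cochar T (basis_cochar j) (exp (cnj c))"
    by (simp add: gal_cochar_apply exp_cnj)
  also have "\<dots> = E (\<sigma> ?e)"
  proof (rule \<phi>_eqI)
    fix i assume i: "i < r"
    have "\<sigma> ?e i = (\<Sum>k<r. of_int (gal_matrix i k) * cnj (?e k))"
      using i by (simp add: \<sigma>_def)
    also have "\<dots> = (\<Sum>k<r. if k = j then of_int (gal_matrix i j) * cnj c else 0)"
      by (intro sum.cong) auto
    also have "\<dots> = of_int (gal_matrix i j) * cnj c"
      using j by simp
    finally show "\<phi> (gal_cochar T (basis_cochar j) (exp (cnj c))) i = \<phi> (E (\<sigma> ?e)) i"
      using i b by (simp add: \<phi>_E \<phi>_cochar gal_cochar_closed gal_matrix_def exp_power_int)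
  qed (simp_all add: E_closed cochar_closed gal_cochar_closed b)
  finally show ?thesis .
qed

text \<open>Both sides are additive in \<open>w\<close>, which is a sum of vectors on the axes.\<close>

lemma E_\<sigma>:
  assumes w: "w \<in> W"
  shows "E (\<sigma> w) = \<gamma> (E w)"
proof -
  have "E (\<sigma> (\<lambda>i. if i < n then w i else 0)) = \<gamma> (E (\<lambda>i. if i < n then w i else 0))" if "n \<le> r" for n
    using that
  proof (induction n)
    case 0
    have "E (\<lambda>i. 0) = \<one>"
      by (rule \<phi>_eqI) (simp_all add: E_closed \<phi>_E \<phi>_one)
    moreover have "\<sigma> (\<lambda>i. 0) = (\<lambda>i. 0)"
      by (simp add: \<sigma>_def fun_eq_iff)
    ultimately show ?case
      by simp
  next
    case (Suc n)
    let ?v = "\<lambda>i. if i < n then w i else 0" and ?e = "\<lambda>i. if i = n then w n else 0"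
    have eq: "(\<lambda>i. if i < Suc n then w i else 0) = ?v + ?e"
      by (auto simp: fun_eq_iff less_Suc_eq)
    have v: "E (\<sigma> ?v) = \<gamma> (E ?v)"
      using Suc by simp
    have e: "E (\<sigma> ?e) = \<gamma> (E ?e)"
      by (rule E_\<sigma>_axis[symmetric]) (use Suc.prems in simp)
    show ?case
      unfolding eq \<sigma>_add E_add gal_point_mult[OF E_closed E_closed] v e by (rule refl)
  qed
  moreover have "(\<lambda>i. if i < r then w i else 0) = w"
    using w by (auto simp: W_def fun_eq_iff)
  ultimately show ?thesis
    by (metis order_refl)
qed

lemma E_onto: "E ` W = carrier T"
proof
  show "E ` W \<subseteq> carrier T"
    using E_closed by auto
  show "carrier T \<subseteq> E ` W"
  proof
    fix x assume x: "x \<in> carrier T"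
    have "x = E (\<lambda>i. if i < r then Ln (\<phi> x i) else 0)"
      using x by (intro \<phi>_eqI) (simp_all add: E_closed \<phi>_E \<phi>_nonzero)
    then show "x \<in> E ` W"
      by (auto simp: W_def)
  qed
qed

text \<open>
  \<open>gal_matrix\<close> describes the action on all cocharacters, not only on the basis. The logarithm of the
  point \<open>\<nu> 2\<close> is a real multiple of the vector of weights, and \<open>E_\<sigma>\<close> computes its conjugate.
\<close>

lemma weight_gal_cochar:
  assumes \<nu>: "\<nu> \<in> carrier X" and i: "i < r"
  shows "weight (gal_cochar T \<nu>) i = (\<Sum>j<r. gal_matrix i j * weight \<nu> j)"
proof (rule weight_eqI)
  let ?w = "\<lambda>i. if i < r then of_int (weight \<nu> i) * of_real (ln 2) else 0 :: complex"
  have exp_ln_2: "exp (of_real (ln 2)) = (2::complex)"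
    by (simp add: exp_of_real)
  have "E ?w = \<nu> 2"
    using \<nu> by (intro \<phi>_eqI)
      (simp_all add: E_closed cochar_closed \<phi>_E \<phi>_cochar exp_ln_2 flip: exp_power_int)
  then have "gal_cochar T \<nu> 2 = E (\<sigma> ?w)"
    by (subst E_\<sigma>) (simp_all add: W_def gal_cochar_apply)
  moreover have "\<sigma> ?w i = of_int (\<Sum>j<r. gal_matrix i j * weight \<nu> j) * of_real (ln 2)"
    using i by (simp add: \<sigma>_def sum_distrib_right mult.assoc)
  ultimately show "\<phi> (gal_cochar T \<nu> 2) i = 2 powi (\<Sum>j<r. gal_matrix i j * weight \<nu> j)"
    using i by (simp add: \<phi>_E exp_ln_2 flip: exp_power_int del: of_int_sum)
qed (use \<nu> i in \<open>simp_all add: gal_cochar_closed\<close>)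

lemma gal_matrix_square:
  assumes "i < r" "j < r"
  shows "(\<Sum>k<r. gal_matrix i k * gal_matrix k j) = (if i = j then 1 else 0)"
proof -
  let ?b = "basis_cochar j"
  have b: "?b \<in> carrier X"
    by (simp add: basis_cochar_def cochar_of_closed)
  have "(\<Sum>k<r. gal_matrix i k * gal_matrix k j) = weight (gal_cochar T (gal_cochar T ?b)) i"
    using b assms(1) by (subst weight_gal_cochar) (simp_all add: gal_cochar_closed gal_matrix_def)
  also have "\<dots> = weight ?b i"
    using b by (simp add: gal_cochar_involution)
  also have "\<dots> = (if i = j then 1 else 0)"
    using assms by (simp add: basis_cochar_def weight_cochar_of)
  finally show ?thesis .
qed

lemma \<sigma>_\<sigma>:
  assumes w: "w \<in> W"
  shows "\<sigma> (\<sigma> w) = w"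
proof
  fix i
  show "\<sigma> (\<sigma> w) i = w i"
  proof (cases "i < r")
    case False
    then show ?thesis
      using w by (simp add: \<sigma>_def W_def)
  next
    case True
    have "\<sigma> (\<sigma> w) i =
        (\<Sum>k<r. \<Sum>j<r. of_int (gal_matrix i k * gal_matrix k j) * w j)"
      using True by (simp add: \<sigma>_def sum_distrib_left mult.assoc)
    also have "\<dots> = (\<Sum>j<r. of_int (\<Sum>k<r. gal_matrix i k * gal_matrix k j) * w j)"
      by (subst sum.swap) (simp add: sum_distrib_right)
    also have "\<dots> = (\<Sum>j<r. if j = i then w j else 0)"
      using True by (intro sum.cong) (auto simp: gal_matrix_square simp del: of_int_sum of_int_mult)
    also have "\<dots> = w i"
      using True by simp
    finally show ?thesis .
  qed
qed

lemma \<sigma>_\<iota>: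
  assumes \<nu>: "\<nu> \<in> carrier X"
  shows "\<sigma> (\<iota> \<nu>) = - \<iota> (gal_cochar T \<nu>)"
  using \<nu> by (auto simp: \<sigma>_def \<iota>_def fun_eq_iff weight_gal_cochar sum_distrib_left sum_negf[symmetric]
      intro!: sum.cong)

lemma E_kernel:
  assumes w: "w \<in> W" "E w = \<one>"
  shows "\<exists>\<nu>\<in>carrier X. w = \<iota> \<nu> + \<iota> \<nu>"
proof -
  have "\<exists>n::int. w i = \<i> * pi * of_int n + \<i> * pi * of_int n" if i: "i < r" for i
  proof -
    have "exp (w i) = 1"
      using w(2) i \<phi>_E[OF i, of w] by (simp add: \<phi>_one)
    then obtain n :: int where "Re (w i) = 0" "Im (w i) = of_int (2 * n) * pi"
      using exp_eq_1 by blast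
    then have "w i = \<i> * pi * of_int n + \<i> * pi * of_int n"
      by (simp add: complex_eq_iff)
    then show ?thesis ..
  qed
  then obtain n :: "nat \<Rightarrow> int"
    where n: "\<And>i. i < r \<Longrightarrow> w i = \<i> * pi * of_int (n i) + \<i> * pi * of_int (n i)"
    by metis
  have "w = \<iota> (cochar_of n) + \<iota> (cochar_of n)"
    using w(1) by (auto simp: fun_eq_iff \<iota>_def W_def weight_cochar_of n)
  then show ?thesis
    using cochar_of_closed by blast
qed

text \<open>This is \<open>exp (\<pi>i n) = (-1)\<^sup>n\<close> in each coordinate.\<close>

lemma E_\<iota>: "\<nu> \<in> carrier X \<Longrightarrow> E (\<iota> \<nu>) = ev_minus_one \<nu>"
proof (rule \<phi>_eqI)
  fix i assume \<nu>: "\<nu> \<in> carrier X" and i: "i < r"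
  have "exp (\<iota> \<nu> i) = exp (\<i> * pi) powi weight \<nu> i"
    using i by (simp add: \<iota>_def exp_power_int mult_ac del: exp_pi_i exp_pi_i')
  then show "\<phi> (E (\<iota> \<nu>)) i = \<phi> (ev_minus_one \<nu>) i"
    using i \<nu> by (simp add: \<phi>_E ev_minus_one_def \<phi>_cochar)
qed (simp_all add: E_closed ev_minus_one_def cochar_closed)

sublocale seq: exponential_sequence X "gal_cochar T" T \<gamma> ev_minus_one W \<sigma> E \<iota>
proof
  show "v + w \<in> W" if "v \<in> W" "w \<in> W" for v w
    using that by (simp add: W_def)
  show "- w \<in> W" if "w \<in> W" for w
    using that by (simp add: W_def)
  show "\<exists>h\<in>W. h + h = w" if "w \<in> W" for w
    using that by (intro bexI[of _ "\<lambda>i. w i / 2"]) (auto simp: W_def fun_eq_iff)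
  show "w = 0" if "w + w = 0" for w :: "nat \<Rightarrow> complex"
    using that by (auto simp: fun_eq_iff)
  show "\<sigma> w \<in> W" for w
    by (simp add: \<sigma>_def W_def)
  show "\<iota> \<nu> \<in> W" for \<nu>
    by (simp add: \<iota>_def W_def)
  show "\<iota> (\<mu> \<otimes>\<^bsub>X\<^esub> \<nu>) = \<iota> \<mu> + \<iota> \<nu>" if "\<mu> \<in> carrier X" "\<nu> \<in> carrier X" for \<mu> \<nu>
    using that by (auto simp: \<iota>_def fun_eq_iff weight_mult distrib_left)
  show "inj_on \<iota> (carrier X)"
  proof (rule inj_onI)
    fix \<mu> \<nu> assume \<mu>\<nu>: "\<mu> \<in> carrier X" "\<nu> \<in> carrier X" "\<iota> \<mu> = \<iota> \<nu>"
    have "weight \<mu> i = weight \<nu> i" if "i < r" for i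
      using fun_cong[OF \<mu>\<nu>(3), of i] that by (simp add: \<iota>_def)
    then show "\<mu> = \<nu>"
      using \<mu>\<nu> by (intro weight_inject)
  qed
  show "\<exists>\<nu>\<in>carrier X. w = \<iota> \<nu> + \<iota> \<nu>" if "w \<in> W" "E w = \<one>" for w
    using that by (rule E_kernel)
qed (simp_all add: \<sigma>_add \<sigma>_\<sigma> \<sigma>_\<iota> E_add E_onto E_\<sigma> E_\<iota>)

end

section \<open>Evaluation at \<open>-1\<close> on Tate cohomology\<close>

lemma real_torus_trivialization:
  assumes "real_torus T"
  obtains r \<phi> \<psi> where "trivialized_torus T r \<phi> \<psi>"
proof -
  interpret affine_algebraic_group \<real> T
    using assms by (simp add: real_torus_def)
  obtain r where "alg_group_isomorphic (base_change T) (Gm_power r)"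
    using assms by (auto simp: real_torus_def)
  then obtain \<phi> \<psi> where "\<phi> \<in> alg_group_hom (base_change T) (Gm_power r)"
    "\<psi> \<in> alg_group_hom (Gm_power r) (base_change T)"
    "\<forall>x\<in>carrier (base_change T). \<psi> (\<phi> x) = x" "\<forall>y\<in>carrier (Gm_power r). \<phi> (\<psi> y) = y"
    unfolding alg_group_isomorphic_def by blast
  then have "trivialized_torus T r \<phi> \<psi>"
    by unfold_locales (simp_all add: base_change_def)
  with that show thesis .
qed

theorem theorem3p6:
  fixes T :: "'a affine_grp" and k :: int
  assumes "real_torus T"
  shows "ev_minus_one \<in> hom (cochar_group T) T \<and>
    (\<forall>\<nu>\<in>carrier (cochar_group T).
       gal_cochar T \<nu> \<in> carrier (cochar_group T) \<and>
       ev_minus_one (gal_cochar T \<nu>) = gal_point T (ev_minus_one \<nu>)) \<and>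
    (\<forall>\<nu>\<in>tate_Z (cochar_group T) (gal_cochar T) k.
       ev_minus_one \<nu> \<in> tate_Z T (gal_point T) k \<and>
       tate_map T (gal_point T) k ev_minus_one
           (tate_class (cochar_group T) (gal_cochar T) k \<nu>)
         = tate_class T (gal_point T) k (ev_minus_one \<nu>)) \<and>
    tate_map T (gal_point T) k ev_minus_one
      \<in> iso (tate_H (cochar_group T) (gal_cochar T) k) (tate_H T (gal_point T) k)"
proof -
  obtain r \<phi> \<psi> where "trivialized_torus T r \<phi> \<psi>"
    using real_torus_trivialization[OF assms] .
  then interpret trivialized_torus T r \<phi> \<psi> .
  have "\<nu> \<in> carrier X" if "\<nu> \<in> tate_Z X (gal_cochar T) k" for \<nu>
    using that by (simp add: tate_Z_def)
  moreover have "tate_map T (gal_point T) k ev_minus_one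
      \<in> iso (tate_H X (gal_cochar T) k) (tate_H T (gal_point T) k)"
    using seq.coboundary_if_ev_coboundary seq.cocycle_is_coboundary_times_ev by (rule ev.tate_map_iso)
  ultimately show ?thesis
    by (simp add: ev_hom gal_cochar_closed ev.equivariant ev.image_tate_Z ev.tate_map_class)
qed

end
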